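(* Let $L$ be a finite lattice. Then the natural rectangular extension map $j_L\colon L\hookrightarrow\operatorname{Rect}L$ has the Dimension Extension Property, that is, the monoid homomorphism $\operatorname{Dim}(j_L)\colon\operatorname{Dim}L\to\operatorname{Dim}(\operatorname{Rect}L)$ is an embedding of preordered monoids (for the algebraic preorderings of $\operatorname{Dim}L$ and $\operatorname{Dim}(\operatorname{Rect}L)$).
   Context: For a lattice $L$, the dimension monoid $\operatorname{Dim}L$ is the commutative monoid defined by generators $\Delta_L(a,b)$ (for $a\leq b$ in $L$) and the relations: (D0) $\Delta_L(a,a)=0$ for all $a\in L$; (D1) $\Delta_L(a,c)=\Delta_L(a,b)+\Delta_L(b,c)$ for all $a\leq b\leq c$ in $L$; (D2) $\Delta_L(a,a\vee b)=\Delta_L(a\wedge b,b)$ for all $a,b\in L$. Every lattice homomorphism $f\colon K\to L$ induces a unique monoid homomorphism $\operatorname{Dim}f\colon\operatorname{Dim}K\to\operatorname{Dim}L$ such that $(\operatorname{Dim}f)(\Delta_K(a,b))=\Delta_L(f(a),f(b))$ for all $a\leq b$ in $K$. The algebraic preordering of a commutative monoid $M$ is: $x\leq y$ iff there is $z\in M$ with $x+z=y$. A monoid homomorphism $g\colon M\to N$ is an embedding of preordered monoids if it is one-to-one and, for all $x,y\in M$, $x\leq y$ iff $g(x)\leq g(y)$. For a finite lattice $L$, let $\mathrm{M}(\operatorname{Con}L)$ be the set of all meet-irreducible congruences of $L$ other than the coarse (full) congruence. The rectangular extension of $L$ is $\operatorname{Rect}L=\prod_{p\in\mathrm{M}(\operatorname{Con}L)}L/p$,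 and $j_L\colon L\to\operatorname{Rect}L$ is the lattice embedding $j_L(x)=\langle[x]_p\mid p\in\mathrm{M}(\operatorname{Con}L)\rangle$, where $[x]_p$ is the class of $x$ modulo $p$. *)

theory Defs
  imports "HOL-Algebra.Group" "HOL-Library.Multiset"
begin

section \<open>The dimension monoid of a lattice\<close>

definition intervals :: "('a, 'b) gorder_scheme \<Rightarrow> ('a \<times> 'a) set" where
  "intervals L = {(a, b). a \<in> carrier L \<and> b \<in> carrier L \<and> a \<sqsubseteq>\<^bsub>L\<^esub> b}"

text \<open>
  The free commutative monoid on the intervals, realised by finite multisets; the singleton
  \<open>{#(a, b)#}\<close> is the formal generator for \<open>a \<sqsubseteq> b\<close>.
\<close>

definition free_dim :: "('a, 'b) gorder_scheme \<Rightarrow> ('a \<times> 'a) multiset set" where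
  "free_dim L = {M. set_mset M \<subseteq> intervals L}"

inductive_set dim_cong ::
  "('a, 'b) gorder_scheme \<Rightarrow> (('a \<times> 'a) multiset \<times> ('a \<times> 'a) multiset) set"
  for L (structure) where
  refl: "M \<in> free_dim L \<Longrightarrow> (M, M) \<in> dim_cong L"
| sym: "(M, N) \<in> dim_cong L \<Longrightarrow> (N, M) \<in> dim_cong L"
| trans: "\<lbrakk>(M, N) \<in> dim_cong L; (N, P) \<in> dim_cong L\<rbrakk> \<Longrightarrow> (M, P) \<in> dim_cong L"
| add: "\<lbrakk>(M, N) \<in> dim_cong L; (M', N') \<in> dim_cong L\<rbrakk> \<Longrightarrow> (M + M', N + N') \<in> dim_cong L"
| D0: "a \<in> carrier L \<Longrightarrow> ({#(a, a)#}, {#}) \<in> dim_cong L"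
| D1: "\<lbrakk>a \<in> carrier L; b \<in> carrier L; c \<in> carrier L; a \<sqsubseteq> b; b \<sqsubseteq> c\<rbrakk>
    \<Longrightarrow> ({#(a, c)#}, {#(a, b), (b, c)#}) \<in> dim_cong L"
| D2: "\<lbrakk>a \<in> carrier L; b \<in> carrier L\<rbrakk>
    \<Longrightarrow> ({#(a, a \<squnion> b)#}, {#(a \<sqinter> b, b)#}) \<in> dim_cong L"

definition Dim :: "('a, 'b) gorder_scheme \<Rightarrow> ('a \<times> 'a) multiset set monoid" where
  "Dim L = \<lparr>carrier = free_dim L // dim_cong L,
            monoid.mult = (\<lambda>X Y. \<Union>M\<in>X. \<Union>N\<in>Y. dim_cong L `` {M + N}),
            one = dim_cong L `` {{#}}\<rparr>"

definition Delta :: "('a, 'b) gorder_scheme \<Rightarrow> 'a \<Rightarrow> 'a \<Rightarrow> ('a \<times> 'a) multiset set" where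
  "Delta L a b = dim_cong L `` {{#(a, b)#}}"

text \<open>
  For a lattice homomorphism \<open>f\<close>, the map below is well defined and is the unique monoid
  homomorphism sending each \<open>Delta K a b\<close> to \<open>Delta L (f a) (f b)\<close>; see
  \<open>Dim_map_hom\<close>, \<open>Dim_map_Delta\<close> and \<open>Dim_map_unique\<close>.
\<close>

definition Dim_map ::
  "('a, 'c) gorder_scheme \<Rightarrow> ('b, 'd) gorder_scheme \<Rightarrow> ('a \<Rightarrow> 'b)
    \<Rightarrow> ('a \<times> 'a) multiset set \<Rightarrow> ('b \<times> 'b) multiset set" where
  "Dim_map K L f =
     (\<lambda>X\<in>carrier (Dim K). \<Union>M\<in>X. dim_cong L `` {image_mset (map_prod f f) M})"

definition lattice_hom ::
  "('a, 'c) gorder_scheme \<Rightarrow> ('b, 'd) gorder_scheme \<Rightarrow> ('a \<Rightarrow> 'b) set" where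
  "lattice_hom K L = {f \<in> carrier K \<rightarrow> carrier L. \<forall>x\<in>carrier K. \<forall>y\<in>carrier K.
     f (x \<squnion>\<^bsub>K\<^esub> y) = f x \<squnion>\<^bsub>L\<^esub> f y \<and> f (x \<sqinter>\<^bsub>K\<^esub> y) = f x \<sqinter>\<^bsub>L\<^esub> f y}"


section \<open>Embeddings of preordered monoids\<close>

definition alg_le :: "('a, 'b) monoid_scheme \<Rightarrow> 'a \<Rightarrow> 'a \<Rightarrow> bool" where
  "alg_le M x y \<longleftrightarrow> (\<exists>z\<in>carrier M. x \<otimes>\<^bsub>M\<^esub> z = y)"

text \<open>\<^const>\<open>hom\<close> does not require the unit to be preserved.\<close>

definition preordered_monoid_embedding ::
  "('a, 'c) monoid_scheme \<Rightarrow> ('b, 'd) monoid_scheme \<Rightarrow> ('a \<Rightarrow> 'b) \<Rightarrow> bool" where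
  "preordered_monoid_embedding M N g \<longleftrightarrow>
     g \<in> hom M N \<and> g \<one>\<^bsub>M\<^esub> = \<one>\<^bsub>N\<^esub> \<and> inj_on g (carrier M) \<and>
     (\<forall>x\<in>carrier M. \<forall>y\<in>carrier M. alg_le M x y \<longleftrightarrow> alg_le N (g x) (g y))"

definition dimension_extension_property ::
  "('a, 'c) gorder_scheme \<Rightarrow> ('b, 'd) gorder_scheme \<Rightarrow> ('a \<Rightarrow> 'b) \<Rightarrow> bool" where
  "dimension_extension_property K L f \<longleftrightarrow>
     preordered_monoid_embedding (Dim K) (Dim L) (Dim_map K L f)"


section \<open>The rectangular extension\<close>

definition congruences :: "('a, 'b) gorder_scheme \<Rightarrow> ('a \<times> 'a) set set" where
  "congruences L = {p. equiv (carrier L) p \<and>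
     (\<forall>(x, x')\<in>p. \<forall>(y, y')\<in>p.
        (x \<squnion>\<^bsub>L\<^esub> y, x' \<squnion>\<^bsub>L\<^esub> y') \<in> p \<and> (x \<sqinter>\<^bsub>L\<^esub> y, x' \<sqinter>\<^bsub>L\<^esub> y') \<in> p)}"

definition Con :: "('a, 'b) gorder_scheme \<Rightarrow> ('a \<times> 'a) set gorder" where
  "Con L = \<lparr>carrier = congruences L, eq = (=), le = (\<subseteq>)\<rparr>"

definition meet_irreducible :: "('a, 'b) gorder_scheme \<Rightarrow> 'a \<Rightarrow> bool" where
  "meet_irreducible L p \<longleftrightarrow> p \<in> carrier L \<and>
     (\<forall>q\<in>carrier L. \<forall>r\<in>carrier L. p = q \<sqinter>\<^bsub>L\<^esub> r \<longrightarrow> p = q \<or> p = r)"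

definition M_Con :: "('a, 'b) gorder_scheme \<Rightarrow> ('a \<times> 'a) set set" where
  "M_Con L = {p. meet_irreducible (Con L) p \<and> p \<noteq> carrier L \<times> carrier L}"

text \<open>
  The quotient lattice is given by its order; that its operations are the ones induced from
  \<open>L\<close> is \<open>quotient_join\<close> and \<open>quotient_meet\<close>.
\<close>

definition quotient_lattice ::
  "('a, 'b) gorder_scheme \<Rightarrow> ('a \<times> 'a) set \<Rightarrow> 'a set gorder" where
  "quotient_lattice L p = \<lparr>carrier = carrier L // p, eq = (=),
     le = (\<lambda>X Y. \<exists>x\<in>X. \<exists>y\<in>Y. x \<sqsubseteq>\<^bsub>L\<^esub> y)\<rparr>"

definition product_lattice ::
  "'i set \<Rightarrow> ('i \<Rightarrow> ('a, 'b) gorder_scheme) \<Rightarrow> ('i \<Rightarrow> 'a) gorder" where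
  "product_lattice I L = \<lparr>carrier = (\<Pi>\<^sub>E i\<in>I. carrier (L i)), eq = (=),
     le = (\<lambda>x y. \<forall>i\<in>I. x i \<sqsubseteq>\<^bsub>L i\<^esub> y i)\<rparr>"

definition Rect :: "('a, 'b) gorder_scheme \<Rightarrow> (('a \<times> 'a) set \<Rightarrow> 'a set) gorder" where
  "Rect L = product_lattice (M_Con L) (quotient_lattice L)"

definition rect_map :: "('a, 'b) gorder_scheme \<Rightarrow> 'a \<Rightarrow> ('a \<times> 'a) set \<Rightarrow> 'a set" where
  "rect_map L x = (\<lambda>p\<in>M_Con L. p `` {x})"


section \<open>Basic properties\<close>

subsection \<open>The dimension monoid\<close>

lemma dim_cong_subset:
  assumes "lattice L"
  shows "(M, N) \<in> dim_cong L \<Longrightarrow> M \<in> free_dim L \<and> N \<in> free_dim L"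
proof (induction rule: dim_cong.induct)
  case (D1 a b c)
  interpret lattice L by fact
  show ?case using D1 le_trans[of a b c] by (auto simp: free_dim_def intervals_def)
next
  case (D2 a b)
  interpret lattice L by fact
  show ?case using D2 join_left meet_right by (auto simp: free_dim_def intervals_def)
next
  case (D0 a)
  interpret lattice L by fact
  show ?case using D0 by (auto simp: free_dim_def intervals_def)
qed (auto simp: free_dim_def)

lemma equiv_dim_cong: "lattice L \<Longrightarrow> equiv (free_dim L) (dim_cong L)"
  using dim_cong_subset[of L]
  by (intro equivI) (auto intro!: refl_onI symI transI intro: dim_cong.intros)

lemma Dim_mult_class:
  assumes "lattice L" "M \<in> free_dim L" "N \<in> free_dim L"
  shows "(dim_cong L `` {M}) \<otimes>\<^bsub>Dim L\<^esub> (dim_cong L `` {N}) = dim_cong L `` {M + N}"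
proof -
  note E = equiv_dim_cong[OF assms(1)]
  have eq: "dim_cong L `` {M' + N'} = dim_cong L `` {M + N}"
    if "M' \<in> dim_cong L `` {M}" "N' \<in> dim_cong L `` {N}" for M' N'
    using equiv_class_eq[OF E dim_cong.add[of M M' L N N']] that by simp
  have M: "M \<in> dim_cong L `` {M}" and N: "N \<in> dim_cong L `` {N}"
    using assms by (simp_all add: dim_cong.refl)
  have "(\<Union>N'\<in>dim_cong L `` {N}. dim_cong L `` {M' + N'}) = dim_cong L `` {M + N}"
    if "M' \<in> dim_cong L `` {M}" for M'
    using eq[OF that] by (intro UN_constant_eq[OF N]) blast
  then show ?thesis unfolding Dim_def monoid.simps by (intro UN_constant_eq[OF M]) blast
qed

lemma carrier_DimE:
  assumes "X \<in> carrier (Dim L)"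
  obtains M where "M \<in> free_dim L" "X = dim_cong L `` {M}"
  using assms by (auto simp: Dim_def elim: quotientE)

lemma class_in_Dim: "M \<in> free_dim L \<Longrightarrow> dim_cong L `` {M} \<in> carrier (Dim L)"
  by (auto simp: Dim_def intro: quotientI)

lemma free_dim_add: "M \<in> free_dim L \<Longrightarrow> N \<in> free_dim L \<Longrightarrow> M + N \<in> free_dim L"
  by (auto simp: free_dim_def)

lemma free_dim_empty: "{#} \<in> free_dim L"
  by (auto simp: free_dim_def)

lemma one_Dim: "\<one>\<^bsub>Dim L\<^esub> = dim_cong L `` {{#}}"
  by (simp add: Dim_def)

lemma comm_monoid_Dim:
  assumes "lattice L"
  shows "comm_monoid (Dim L)"
proof (rule comm_monoidI)
  show "\<one>\<^bsub>Dim L\<^esub> \<in> carrier (Dim L)"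
    by (simp add: one_Dim class_in_Dim free_dim_empty)
qed (auto elim!: carrier_DimE
      simp: Dim_mult_class[OF assms] one_Dim free_dim_empty free_dim_add class_in_Dim ac_simps)

lemma lattice_hom_le:
  assumes "lattice K" "lattice L" "f \<in> lattice_hom K L"
    "x \<in> carrier K" "y \<in> carrier K" "x \<sqsubseteq>\<^bsub>K\<^esub> y"
  shows "f x \<sqsubseteq>\<^bsub>L\<^esub> f y"
proof -
  interpret K: lattice K by fact
  interpret L: lattice L by fact
  have "x = x \<sqinter>\<^bsub>K\<^esub> y" using K.le_iff_join assms(4-6) by blast
  moreover have "f (x \<sqinter>\<^bsub>K\<^esub> y) = f x \<sqinter>\<^bsub>L\<^esub> f y"
    using assms(3-5) by (simp add: lattice_hom_def)
  ultimately have "f x = f x \<sqinter>\<^bsub>L\<^esub> f y" by simp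
  moreover have "f x \<in> carrier L" "f y \<in> carrier L"
    using assms(3-5) by (auto simp: lattice_hom_def)
  ultimately show ?thesis using L.meet_right[of "f x" "f y"] by simp
qed

lemma Dim_map_free:
  assumes "lattice K" "lattice L" "f \<in> lattice_hom K L" "M \<in> free_dim K"
  shows "image_mset (map_prod f f) M \<in> free_dim L"
proof -
  have *: "map_prod f f i \<in> intervals L" if "i \<in> intervals K" for i
    using that assms(3) lattice_hom_le[OF assms(1-3)]
    by (cases i) (auto simp: intervals_def lattice_hom_def)
  have "set_mset M \<subseteq> intervals K"
    using assms(4) by (simp add: free_dim_def)
  then have "map_prod f f ` set_mset M \<subseteq> intervals L"
    by (intro image_subsetI *) (rule subsetD)
  then show ?thesis by (simp add: free_dim_def)
qed

lemma Dim_map_cong: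
  assumes "lattice K" "lattice L" "f \<in> lattice_hom K L"
  shows "(M, N) \<in> dim_cong K \<Longrightarrow>
    (image_mset (map_prod f f) M, image_mset (map_prod f f) N) \<in> dim_cong L"
proof (induction rule: dim_cong.induct)
  case (refl M)
  then show ?case using Dim_map_free[OF assms] by (auto intro: dim_cong.refl)
next
  case (D1 a b c)
  then have "f a \<in> carrier L" "f b \<in> carrier L" "f c \<in> carrier L"
    using assms(3) by (auto simp: lattice_hom_def)
  then show ?case using D1 lattice_hom_le[OF assms] by (auto intro!: dim_cong.D1)
next
  case (D2 a b)
  then have "f a \<in> carrier L" "f b \<in> carrier L"
    "f (a \<squnion>\<^bsub>K\<^esub> b) = f a \<squnion>\<^bsub>L\<^esub> f b" "f (a \<sqinter>\<^bsub>K\<^esub> b) = f a \<sqinter>\<^bsub>L\<^esub> f b"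
    using assms(3) by (auto simp: lattice_hom_def)
  then show ?case by (simp add: dim_cong.D2)
next
  case (D0 a)
  then have "f a \<in> carrier L" using assms(3) by (auto simp: lattice_hom_def)
  then show ?case by (simp add: dim_cong.D0)
next
  case (sym M N)
  from sym.IH show ?case by (rule dim_cong.sym)
next
  case (trans M N P)
  from trans.IH show ?case by (rule dim_cong.trans)
next
  case (add M N M' N')
  then show ?case by (simp add: dim_cong.add)
qed

lemma Dim_map_class:
  assumes "lattice K" "lattice L" "f \<in> lattice_hom K L" "M \<in> free_dim K"
  shows "Dim_map K L f (dim_cong K `` {M}) = dim_cong L `` {image_mset (map_prod f f) M}"
proof -
  have eq: "dim_cong L `` {image_mset (map_prod f f) N} = dim_cong L `` {image_mset (map_prod f f) M}"
    if "N \<in> dim_cong K `` {M}" for N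
    using equiv_class_eq[OF equiv_dim_cong[OF assms(2)] Dim_map_cong[OF assms(1-3), of M N]] that
    by simp
  have M: "M \<in> dim_cong K `` {M}" using assms(4) by (simp add: dim_cong.refl)
  show ?thesis
    unfolding Dim_map_def restrict_apply' [OF class_in_Dim[OF assms(4)]]
    using eq by (intro UN_constant_eq[OF M]) blast
qed

lemma Dim_map_hom:
  assumes "lattice K" "lattice L" "f \<in> lattice_hom K L"
  shows "Dim_map K L f \<in> hom (Dim K) (Dim L)"
    and "Dim_map K L f \<one>\<^bsub>Dim K\<^esub> = \<one>\<^bsub>Dim L\<^esub>"
  by (auto intro!: homI elim!: carrier_DimE simp: Dim_map_class[OF assms] one_Dim free_dim_empty
      class_in_Dim Dim_map_free[OF assms] Dim_mult_class assms(1,2) free_dim_add)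

lemma Dim_map_Delta:
  assumes "lattice K" "lattice L" "f \<in> lattice_hom K L"
    "a \<in> carrier K" "b \<in> carrier K" "a \<sqsubseteq>\<^bsub>K\<^esub> b"
  shows "Dim_map K L f (Delta K a b) = Delta L (f a) (f b)"
  using assms(4-6) Dim_map_class[OF assms(1-3), of "{#(a, b)#}"]
  by (auto simp: Delta_def free_dim_def intervals_def)

lemma Dim_map_unique:
  assumes "lattice K" "lattice L" "f \<in> lattice_hom K L"
    and g: "g \<in> hom (Dim K) (Dim L)" "g \<one>\<^bsub>Dim K\<^esub> = \<one>\<^bsub>Dim L\<^esub>"
    and Delta: "\<And>a b. \<lbrakk>a \<in> carrier K; b \<in> carrier K; a \<sqsubseteq>\<^bsub>K\<^esub> b\<rbrakk>
      \<Longrightarrow> g (Delta K a b) = Delta L (f a) (f b)"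
    and X: "X \<in> carrier (Dim K)"
  shows "g X = Dim_map K L f X"
proof -
  obtain M where M: "M \<in> free_dim K" "X = dim_cong K `` {M}"
    using X by (rule carrier_DimE)
  from M(1) have "g (dim_cong K `` {M}) = Dim_map K L f (dim_cong K `` {M})"
  proof (induction M)
    case empty
    then show ?case using g(2) Dim_map_hom(2)[OF assms(1-3)] by (simp add: one_Dim)
  next
    case (add i M)
    obtain a b where i: "i = (a, b)" by fastforce
    have ab: "a \<in> carrier K" "b \<in> carrier K" "a \<sqsubseteq>\<^bsub>K\<^esub> b"
      and M: "M \<in> free_dim K" "{#(a, b)#} \<in> free_dim K"
      using add.prems by (auto simp: i free_dim_def intervals_def)
    have eq: "dim_cong K `` {add_mset i M} = Delta K a b \<otimes>\<^bsub>Dim K\<^esub> (dim_cong K `` {M})"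
      using Dim_mult_class[OF assms(1) M(2,1)] by (simp add: i Delta_def)
    have "Delta K a b \<in> carrier (Dim K)" using M(2) by (simp add: Delta_def class_in_Dim)
    then show ?case
      using add.IH[OF M(1)] Delta[OF ab] Dim_map_Delta[OF assms(1-3) ab]
        hom_mult[OF g(1)] hom_mult[OF Dim_map_hom(1)[OF assms(1-3)]] class_in_Dim[OF M(1)]
      by (simp add: eq)
  qed
  then show ?thesis using M by simp
qed


subsection \<open>Congruences, quotients and products\<close>

lemma (in lattice) join_eqI:
  "\<lbrakk>x \<in> carrier L; y \<in> carrier L; least L s (Upper L {x, y})\<rbrakk> \<Longrightarrow> x \<squnion> y = s"
  by (rule joinI) (auto intro: least_unique)

lemma (in lattice) meet_eqI:
  "\<lbrakk>x \<in> carrier L; y \<in> carrier L; greatest L s (Lower L {x, y})\<rbrakk> \<Longrightarrow> x \<sqinter> y = s"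
  by (rule meetI) (auto intro: greatest_unique)

lemma congruence_Inter:
  assumes "P \<subseteq> congruences L" "P \<noteq> {}"
  shows "\<Inter>P \<in> congruences L"
proof -
  have P: "p \<subseteq> carrier L \<times> carrier L" "refl_on (carrier L) p" "sym p" "trans p"
    "\<And>x x' y y'. \<lbrakk>(x, x') \<in> p; (y, y') \<in> p\<rbrakk>
      \<Longrightarrow> (x \<squnion>\<^bsub>L\<^esub> y, x' \<squnion>\<^bsub>L\<^esub> y') \<in> p \<and> (x \<sqinter>\<^bsub>L\<^esub> y, x' \<sqinter>\<^bsub>L\<^esub> y') \<in> p"
    if "p \<in> P" for p
  proof -
    have "p \<in> congruences L" using assms(1) that by (rule subsetD)
    then show "p \<subseteq> carrier L \<times> carrier L" "refl_on (carrier L) p" "sym p" "trans p"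
      "\<And>x x' y y'. \<lbrakk>(x, x') \<in> p; (y, y') \<in> p\<rbrakk>
        \<Longrightarrow> (x \<squnion>\<^bsub>L\<^esub> y, x' \<squnion>\<^bsub>L\<^esub> y') \<in> p \<and> (x \<sqinter>\<^bsub>L\<^esub> y, x' \<sqinter>\<^bsub>L\<^esub> y') \<in> p"
      unfolding congruences_def equiv_def by blast+
  qed
  have "equiv (carrier L) (\<Inter>P)"
  proof (rule equivI)
    show "\<Inter>P \<subseteq> carrier L \<times> carrier L" using assms(2) P(1) by blast
    show "refl_on (carrier L) (\<Inter>P)" using P(2) by (simp add: refl_on_def)
    show "sym (\<Inter>P)" using P(3) by (auto intro!: symI dest: symD)
    show "trans (\<Inter>P)" by (intro transI InterI) (meson InterD P(4) transD)
  qed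
  then show ?thesis using P(5) by (auto simp: congruences_def)
qed

lemma (in lattice) full_congruence: "carrier L \<times> carrier L \<in> congruences L"
  by (auto simp: congruences_def intro!: equivI refl_onI symI transI)

lemma (in lattice) lattice_Con: "lattice (Con L)"
proof unfold_locales
  fix p q assume pq: "p \<in> carrier (Con L)" "q \<in> carrier (Con L)"
  let ?P = "{r \<in> congruences L. p \<subseteq> r \<and> q \<subseteq> r}"
  have "carrier L \<times> carrier L \<in> ?P"
    using pq full_congruence by (auto simp: Con_def congruences_def equiv_def)
  then have "\<Inter>?P \<in> congruences L" by (intro congruence_Inter) auto
  then have "least (Con L) (\<Inter>?P) (Upper (Con L) {p, q})"
    using pq by (auto simp: least_def Upper_def Con_def)
  then show "\<exists>s. least (Con L) s (Upper (Con L) {p, q})" by blast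
  have "p \<inter> q \<in> congruences L"
    using congruence_Inter[of "{p, q}" L] pq by (auto simp: Con_def)
  then have "greatest (Con L) (p \<inter> q) (Lower (Con L) {p, q})"
    using pq by (auto simp: greatest_def Lower_def Con_def)
  then show "\<exists>s. greatest (Con L) s (Lower (Con L) {p, q})" by blast
qed (auto simp: Con_def)

lemma (in lattice) Con_meet:
  assumes "p \<in> congruences L" "q \<in> congruences L"
  shows "p \<sqinter>\<^bsub>Con L\<^esub> q = p \<inter> q"
proof -
  interpret C: lattice "Con L" by (rule lattice_Con)
  have "p \<inter> q \<in> congruences L"
    using congruence_Inter[of "{p, q}" L] assms by auto
  then show ?thesis
    using assms by (intro C.meet_eqI) (auto simp: greatest_def Lower_def Con_def)
qed

context lattice begin

context
  fixes p assumes p: "p \<in> congruences L"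
begin

lemma congruence_equiv: "equiv (carrier L) p"
  and congruence_join: "(x, x') \<in> p \<Longrightarrow> (y, y') \<in> p \<Longrightarrow> (x \<squnion> y, x' \<squnion> y') \<in> p"
  and congruence_meet: "(x, x') \<in> p \<Longrightarrow> (y, y') \<in> p \<Longrightarrow> (x \<sqinter> y, x' \<sqinter> y') \<in> p"
  using p by (auto simp: congruences_def)

lemma quotient_le_iff:
  assumes x: "x \<in> carrier L" and y: "y \<in> carrier L"
  shows "p `` {x} \<sqsubseteq>\<^bsub>quotient_lattice L p\<^esub> p `` {y} \<longleftrightarrow> (x \<sqinter> y, x) \<in> p"
proof
  note E = congruence_equiv
  assume "p `` {x} \<sqsubseteq>\<^bsub>quotient_lattice L p\<^esub> p `` {y}"
  then obtain x' y' where xy: "(x, x') \<in> p" "(y, y') \<in> p" "x' \<sqsubseteq> y'"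
    by (auto simp: quotient_lattice_def)
  then have "x' = x' \<sqinter> y'"
    using E le_iff_join[of x' y'] by (auto simp: equiv_def)
  then have "(x \<sqinter> y, x') \<in> p" using congruence_meet[OF xy(1,2)] by simp
  then show "(x \<sqinter> y, x) \<in> p" using xy(1) E by (meson equiv_def symD transD)
next
  assume "(x \<sqinter> y, x) \<in> p"
  then have "(x, x \<sqinter> y) \<in> p" "(y, y) \<in> p"
    using congruence_equiv y by (auto simp: equiv_def refl_on_def dest: symD)
  then show "p `` {x} \<sqsubseteq>\<^bsub>quotient_lattice L p\<^esub> p `` {y}"
    using meet_right[OF x y] by (auto simp: quotient_lattice_def)
qed

lemma quotient_carrierE:
  assumes "X \<in> carrier (quotient_lattice L p)"
  obtains x where "x \<in> carrier L" "X = p `` {x}"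
  using assms by (auto simp: quotient_lattice_def elim: quotientE)

lemma class_in_quotient: "x \<in> carrier L \<Longrightarrow> p `` {x} \<in> carrier (quotient_lattice L p)"
  by (auto simp: quotient_lattice_def intro: quotientI)

lemma quotient_le_trans:
  assumes "x \<in> carrier L" "y \<in> carrier L" "z \<in> carrier L" "(x \<sqinter> y, x) \<in> p" "(y \<sqinter> z, y) \<in> p"
  shows "(x \<sqinter> z, x) \<in> p"
proof -
  note E = congruence_equiv
  have r: "(x, x) \<in> p" "(z, z) \<in> p" using E assms by (auto simp: equiv_def refl_on_def)
  have "(x \<sqinter> (y \<sqinter> z), x \<sqinter> y) \<in> p" using congruence_meet[OF r(1) assms(5)] .
  then have "(x \<sqinter> (y \<sqinter> z), x) \<in> p" using assms(4) E by (meson equiv_def transD)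
  moreover have "(x \<sqinter> y \<sqinter> z, x \<sqinter> z) \<in> p" using congruence_meet[OF assms(4) r(2)] .
  moreover have "x \<sqinter> y \<sqinter> z = x \<sqinter> (y \<sqinter> z)"
    using weak_meet_assoc assms(1-3) by (simp add: eq_is_equal)
  ultimately show ?thesis using E by (metis equiv_def symD transD)
qed

lemma quotient_le_join_iff:
  assumes x: "x \<in> carrier L" and y: "y \<in> carrier L"
  shows "(x \<sqinter> y, x) \<in> p \<longleftrightarrow> (x \<squnion> y, y) \<in> p"
proof
  have r: "(x, x) \<in> p" "(y, y) \<in> p"
    using congruence_equiv x y by (auto simp: equiv_def refl_on_def)
  have a: "x \<sqinter> y \<squnion> y = y" "x \<sqinter> (x \<squnion> y) = x"
    using x y by (auto intro!: join_eqI meet_eqI least_UpperI greatest_LowerI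
        intro: meet_right join_left dest: Upper_memD)
  {
    assume "(x \<sqinter> y, x) \<in> p"
    from congruence_join[OF this r(2)] show "(x \<squnion> y, y) \<in> p"
      using a congruence_equiv by (auto simp: equiv_def dest: symD)
  next
    assume "(x \<squnion> y, y) \<in> p"
    from congruence_meet[OF r(1) this] show "(x \<sqinter> y, x) \<in> p"
      using a congruence_equiv by (auto simp: equiv_def dest: symD)
  }
qed

lemma lattice_quotient_aux: "partial_order (quotient_lattice L p)"
proof unfold_locales
  note E = congruence_equiv
  let ?Q = "quotient_lattice L p"
  fix X Y Z
  assume "X \<in> carrier ?Q" "Y \<in> carrier ?Q"
  then obtain x y where x: "x \<in> carrier L" "X = p `` {x}" and y: "y \<in> carrier L" "Y = p `` {y}"
    by (metis quotient_carrierE)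
  have "(x \<sqinter> x, x \<sqinter> x) \<in> p" "x \<sqinter> x = x"
    using E x(1) le_iff_join[of x x] by (auto simp: equiv_def refl_on_def)
  then show "X \<sqsubseteq>\<^bsub>?Q\<^esub> X" using x by (simp add: quotient_le_iff)
  {
    assume "X \<sqsubseteq>\<^bsub>?Q\<^esub> Y" "Y \<sqsubseteq>\<^bsub>?Q\<^esub> X"
    then have "(x \<sqinter> y, x) \<in> p" "(x \<sqinter> y, y) \<in> p"
      using x y by (simp_all add: quotient_le_iff meet_comm[of L y x])
    then have "(x, y) \<in> p" using E by (meson equiv_def symD transD)
    then show "X .=\<^bsub>?Q\<^esub> Y" using equiv_class_eq[OF E] x y by (simp add: quotient_lattice_def)
  next
    assume "Z \<in> carrier ?Q" "X \<sqsubseteq>\<^bsub>?Q\<^esub> Y" "Y \<sqsubseteq>\<^bsub>?Q\<^esub> Z"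
    moreover from this obtain z where z: "z \<in> carrier L" "Z = p `` {z}"
      by (metis quotient_carrierE)
    ultimately show "X \<sqsubseteq>\<^bsub>?Q\<^esub> Z"
      using x y quotient_le_trans[of x y z] by (simp add: quotient_le_iff)
  }
qed (auto simp: quotient_lattice_def)

lemma class_le:
  assumes "x \<in> carrier L" "y \<in> carrier L" "x \<sqsubseteq> y"
  shows "p `` {x} \<sqsubseteq>\<^bsub>quotient_lattice L p\<^esub> p `` {y}"
  using assms congruence_equiv le_iff_join[of x y]
  by (simp add: quotient_le_iff equiv_def refl_on_def)

lemma quotient_greatest:
  assumes x: "x \<in> carrier L" and y: "y \<in> carrier L"
  shows "greatest (quotient_lattice L p) (p `` {x \<sqinter> y})
    (Lower (quotient_lattice L p) {p `` {x}, p `` {y}})"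
proof -
  let ?Q = "quotient_lattice L p"
  interpret Q: partial_order ?Q by (rule lattice_quotient_aux)
  note E = congruence_equiv
  have r: "(z, z) \<in> p" if "z \<in> carrier L" for z
    using E that by (auto simp: equiv_def refl_on_def)
  show ?thesis
  proof (rule greatest_LowerI)
    fix Z assume "Z \<in> {p `` {x}, p `` {y}}"
    then show "p `` {x \<sqinter> y} \<sqsubseteq>\<^bsub>?Q\<^esub> Z"
      using meet_left[OF x y] meet_right[OF x y] x y by (auto intro: class_le)
  next
    fix Z assume Z: "Z \<in> Lower ?Q {p `` {x}, p `` {y}}"
    then have "Z \<in> carrier ?Q" by (simp add: Lower_def)
    then obtain z where z: "z \<in> carrier L" "Z = p `` {z}" by (rule quotient_carrierE)
    have "(z \<sqinter> x, z) \<in> p" "(z \<sqinter> y, z) \<in> p"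
      using Z x y z by (simp_all add: Lower_def quotient_le_iff[symmetric] class_in_quotient)
    moreover from this have "(z \<sqinter> x \<sqinter> y, z \<sqinter> y) \<in> p"
      using congruence_meet r y by blast
    moreover have "z \<sqinter> x \<sqinter> y = z \<sqinter> (x \<sqinter> y)"
      using weak_meet_assoc x y z by (simp add: eq_is_equal)
    ultimately have "(z \<sqinter> (x \<sqinter> y), z) \<in> p" using E by (metis equiv_def transD)
    then show "Z \<sqsubseteq>\<^bsub>?Q\<^esub> p `` {x \<sqinter> y}" using x y z by (simp add: quotient_le_iff)
  qed (use x y in \<open>auto simp: class_in_quotient\<close>)
qed

lemma quotient_least:
  assumes x: "x \<in> carrier L" and y: "y \<in> carrier L"
  shows "least (quotient_lattice L p) (p `` {x \<squnion> y})
    (Upper (quotient_lattice L p) {p `` {x}, p `` {y}})"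
proof -
  let ?Q = "quotient_lattice L p"
  interpret Q: partial_order ?Q by (rule lattice_quotient_aux)
  note E = congruence_equiv
  have r: "(z, z) \<in> p" if "z \<in> carrier L" for z
    using E that by (auto simp: equiv_def refl_on_def)
  show ?thesis
  proof (rule least_UpperI)
    fix Z assume "Z \<in> {p `` {x}, p `` {y}}"
    then show "Z \<sqsubseteq>\<^bsub>?Q\<^esub> p `` {x \<squnion> y}"
      using join_left[OF x y] join_right[OF x y] x y by (auto intro: class_le)
  next
    fix Z assume Z: "Z \<in> Upper ?Q {p `` {x}, p `` {y}}"
    then have "Z \<in> carrier ?Q" by (simp add: Upper_def)
    then obtain z where z: "z \<in> carrier L" "Z = p `` {z}" by (rule quotient_carrierE)
    have "(x \<squnion> z, z) \<in> p" "(y \<squnion> z, z) \<in> p"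
      using Z x y z
      by (simp_all add: Upper_def quotient_le_join_iff[symmetric] quotient_le_iff[symmetric]
          class_in_quotient)
    moreover from this have "(x \<squnion> (y \<squnion> z), x \<squnion> z) \<in> p"
      using congruence_join r x by blast
    moreover have "x \<squnion> y \<squnion> z = x \<squnion> (y \<squnion> z)"
      using weak_join_assoc x y z by (simp add: eq_is_equal)
    ultimately have "(x \<squnion> y \<squnion> z, z) \<in> p" using E by (metis equiv_def transD)
    then show "p `` {x \<squnion> y} \<sqsubseteq>\<^bsub>?Q\<^esub> Z"
      using x y z by (simp add: quotient_le_iff quotient_le_join_iff)
  qed (use x y in \<open>auto simp: class_in_quotient\<close>)
qed

lemma lattice_quotient: "lattice (quotient_lattice L p)"
proof -
  let ?Q = "quotient_lattice L p"
  interpret Q: partial_order ?Q by (rule lattice_quotient_aux)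
  show ?thesis
  proof unfold_locales
    fix X Y assume "X \<in> carrier ?Q" "Y \<in> carrier ?Q"
    then obtain x y where "x \<in> carrier L" "X = p `` {x}" "y \<in> carrier L" "Y = p `` {y}"
      by (metis quotient_carrierE)
    then show "\<exists>s. least ?Q s (Upper ?Q {X, Y})" "\<exists>s. greatest ?Q s (Lower ?Q {X, Y})"
      using quotient_least quotient_greatest by blast+
  qed
qed

lemma quotient_join:
  assumes "x \<in> carrier L" "y \<in> carrier L"
  shows "p `` {x} \<squnion>\<^bsub>quotient_lattice L p\<^esub> p `` {y} = p `` {x \<squnion> y}"
  using assms by (intro lattice.join_eqI lattice_quotient quotient_least class_in_quotient)

lemma quotient_meet:
  assumes "x \<in> carrier L" "y \<in> carrier L"
  shows "p `` {x} \<sqinter>\<^bsub>quotient_lattice L p\<^esub> p `` {y} = p `` {x \<sqinter> y}"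
  using assms by (intro lattice.meet_eqI lattice_quotient quotient_greatest class_in_quotient)

end

end

context
  fixes I :: "'i set" and L :: "'i \<Rightarrow> ('a, 'b) gorder_scheme"
  assumes L: "\<And>i. i \<in> I \<Longrightarrow> lattice (L i)"
begin

lemma product_order_aux: "partial_order (product_lattice I L)"
proof unfold_locales
  fix x y
  assume xy: "x \<in> carrier (product_lattice I L)" "y \<in> carrier (product_lattice I L)"
  have p: "partial_order (L i)" if "i \<in> I" for i
    using L[OF that] by (simp add: lattice_def upper_semilattice_def)
  have c: "x i \<in> carrier (L i)" "y i \<in> carrier (L i)" if "i \<in> I" for i
    using xy that by (auto simp: product_lattice_def)
  show "x \<sqsubseteq>\<^bsub>product_lattice I L\<^esub> x"
    using c p by (simp add: product_lattice_def partial_order_def weak_partial_order.le_refl)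
  {
    assume le: "x \<sqsubseteq>\<^bsub>product_lattice I L\<^esub> y" "y \<sqsubseteq>\<^bsub>product_lattice I L\<^esub> x"
    have "x i = y i" if "i \<in> I" for i
      using le c[OF that] that partial_order.le_antisym[OF p[OF that]]
      by (simp add: product_lattice_def)
    then show "x .=\<^bsub>product_lattice I L\<^esub> y"
      using xy by (auto simp: product_lattice_def intro: PiE_ext)
  next
    fix z
    assume le: "x \<sqsubseteq>\<^bsub>product_lattice I L\<^esub> y" "y \<sqsubseteq>\<^bsub>product_lattice I L\<^esub> z"
      and z: "z \<in> carrier (product_lattice I L)"
    have "x i \<sqsubseteq>\<^bsub>L i\<^esub> z i" if "i \<in> I" for i
    proof -
      interpret partial_order "L i" using p[OF that] .
      have "z i \<in> carrier (L i)" using z that by (auto simp: product_lattice_def)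
      then show ?thesis
        using le c[OF that] that le_trans[of "x i" "y i" "z i"] by (simp add: product_lattice_def)
    qed
    then show "x \<sqsubseteq>\<^bsub>product_lattice I L\<^esub> z" by (simp add: product_lattice_def)
  }
qed (auto simp: product_lattice_def)

lemma product_least_greatest:
  assumes "x \<in> carrier (product_lattice I L)" "y \<in> carrier (product_lattice I L)"
  shows "least (product_lattice I L) (\<lambda>i\<in>I. x i \<squnion>\<^bsub>L i\<^esub> y i) (Upper (product_lattice I L) {x, y})"
    and "greatest (product_lattice I L) (\<lambda>i\<in>I. x i \<sqinter>\<^bsub>L i\<^esub> y i) (Lower (product_lattice I L) {x, y})"
proof -
  interpret P: partial_order "product_lattice I L" by (rule product_order_aux)
  have c: "x i \<in> carrier (L i)" "y i \<in> carrier (L i)" if "i \<in> I" for i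
    using assms that by (auto simp: product_lattice_def)
  have l: "weak_upper_semilattice (L i)" "weak_lower_semilattice (L i)" if "i \<in> I" for i
  proof -
    interpret lattice "L i" using L[OF that] .
    show "weak_upper_semilattice (L i)" "weak_lower_semilattice (L i)" by unfold_locales
  qed
  have cj: "(\<lambda>i\<in>I. x i \<squnion>\<^bsub>L i\<^esub> y i) \<in> carrier (product_lattice I L)"
    "(\<lambda>i\<in>I. x i \<sqinter>\<^bsub>L i\<^esub> y i) \<in> carrier (product_lattice I L)"
    using c l by (auto simp: product_lattice_def weak_upper_semilattice.join_closed
        weak_lower_semilattice.meet_closed)
  show "least (product_lattice I L) (\<lambda>i\<in>I. x i \<squnion>\<^bsub>L i\<^esub> y i) (Upper (product_lattice I L) {x, y})"
  proof (rule least_UpperI)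
    fix z assume "z \<in> {x, y}"
    then show "z \<sqsubseteq>\<^bsub>product_lattice I L\<^esub> (\<lambda>i\<in>I. x i \<squnion>\<^bsub>L i\<^esub> y i)"
      using c l by (auto simp: product_lattice_def weak_upper_semilattice.join_left
          weak_upper_semilattice.join_right)
  next
    fix z assume "z \<in> Upper (product_lattice I L) {x, y}"
    then have "z i \<in> carrier (L i)" "x i \<sqsubseteq>\<^bsub>L i\<^esub> z i" "y i \<sqsubseteq>\<^bsub>L i\<^esub> z i" if "i \<in> I" for i
      using assms that by (auto simp: Upper_def product_lattice_def)
    then show "(\<lambda>i\<in>I. x i \<squnion>\<^bsub>L i\<^esub> y i) \<sqsubseteq>\<^bsub>product_lattice I L\<^esub> z"
      using c l by (simp add: product_lattice_def weak_upper_semilattice.join_le)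
  qed (use assms cj in auto)
  show "greatest (product_lattice I L) (\<lambda>i\<in>I. x i \<sqinter>\<^bsub>L i\<^esub> y i) (Lower (product_lattice I L) {x, y})"
  proof (rule greatest_LowerI)
    fix z assume "z \<in> {x, y}"
    then show "(\<lambda>i\<in>I. x i \<sqinter>\<^bsub>L i\<^esub> y i) \<sqsubseteq>\<^bsub>product_lattice I L\<^esub> z"
      using c l by (auto simp: product_lattice_def weak_lower_semilattice.meet_left
          weak_lower_semilattice.meet_right)
  next
    fix z assume "z \<in> Lower (product_lattice I L) {x, y}"
    then have "z i \<in> carrier (L i)" "z i \<sqsubseteq>\<^bsub>L i\<^esub> x i" "z i \<sqsubseteq>\<^bsub>L i\<^esub> y i" if "i \<in> I" for i
      using assms that by (auto simp: Lower_def product_lattice_def)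
    then show "z \<sqsubseteq>\<^bsub>product_lattice I L\<^esub> (\<lambda>i\<in>I. x i \<sqinter>\<^bsub>L i\<^esub> y i)"
      using c l by (simp add: product_lattice_def weak_lower_semilattice.meet_le)
  qed (use assms cj in auto)
qed

lemma lattice_product: "lattice (product_lattice I L)"
proof -
  interpret P: partial_order "product_lattice I L" by (rule product_order_aux)
  show ?thesis by unfold_locales (blast intro: product_least_greatest)+
qed

lemma product_join_meet:
  assumes "x \<in> carrier (product_lattice I L)" "y \<in> carrier (product_lattice I L)"
  shows "x \<squnion>\<^bsub>product_lattice I L\<^esub> y = (\<lambda>i\<in>I. x i \<squnion>\<^bsub>L i\<^esub> y i)"
    and "x \<sqinter>\<^bsub>product_lattice I L\<^esub> y = (\<lambda>i\<in>I. x i \<sqinter>\<^bsub>L i\<^esub> y i)"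
  using assms product_least_greatest
  by (auto intro: lattice.join_eqI lattice.meet_eqI lattice_product)

end


subsection \<open>The rectangular extension\<close>

context lattice begin

lemma M_Con_congruence: "p \<in> M_Con L \<Longrightarrow> p \<in> congruences L"
  by (simp add: M_Con_def meet_irreducible_def Con_def)

lemma lattice_Rect: "lattice (Rect L)"
  unfolding Rect_def by (intro lattice_product lattice_quotient M_Con_congruence)

lemma rect_map_hom: "rect_map L \<in> lattice_hom L (Rect L)"
proof -
  have c: "rect_map L x \<in> carrier (product_lattice (M_Con L) (quotient_lattice L))"
    if "x \<in> carrier L" for x
    using that by (auto simp: rect_map_def product_lattice_def M_Con_congruence class_in_quotient)
  show ?thesis
    unfolding lattice_hom_def Rect_def
    using c product_join_meet[of "M_Con L" "quotient_lattice L", OF lattice_quotient[OF M_Con_congruence]]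
    by (auto simp: rect_map_def quotient_join quotient_meet M_Con_congruence cong: restrict_cong)
qed

lemma rect_map_inj:
  assumes fin: "finite (carrier L)"
  shows "inj_on (rect_map L) (carrier L)"
proof (rule inj_onI, rule ccontr)
  fix x y assume x: "x \<in> carrier L" and y: "y \<in> carrier L"
    and eq: "rect_map L x = rect_map L y" and ne: "x \<noteq> y"
  let ?S = "{p \<in> congruences L. (x, y) \<notin> p}"
  have "?S \<subseteq> Pow (carrier L \<times> carrier L)"
    by (auto simp: congruences_def equiv_def)
  then have "finite ?S" using fin by (meson finite_Pow_iff finite_SigmaI finite_subset)
  moreover have "Id_on (carrier L) \<in> ?S"
    using ne by (auto simp: congruences_def intro!: equivI refl_onI symI transI)
  ultimately obtain p where p: "p \<in> ?S" and max: "\<And>q. q \<in> ?S \<Longrightarrow> p \<subseteq> q \<Longrightarrow> p = q"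
    using finite_has_maximal[of ?S] by blast
  have carrier_Con: "carrier (Con L) = congruences L" by (simp add: Con_def)
  have "p = q \<or> p = r" if "q \<in> congruences L" "r \<in> congruences L" "p = q \<inter> r" for q r
    using that p max[of q] max[of r] by blast
  then have "meet_irreducible (Con L) p"
    using p carrier_Con by (auto simp: meet_irreducible_def Con_meet)
  then have M: "p \<in> M_Con L" using p x y by (auto simp: M_Con_def)
  then have "p `` {x} = p `` {y}" using eq by (metis rect_map_def restrict_apply')
  then show False
    using p y by (auto simp: congruences_def equiv_def refl_on_def)
qed

end

end

theory Submission
  imports Defs "HOL-Library.Extended_Nat"
begin

text \<open>
  For a covering pair \<open>c \<prec> d\<close> and an element \<open>u\<close> above \<open>c\<close> but not above \<open>d\<close>, every element \<open>a\<close>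
  of the interval from \<open>u\<close> to \<open>v = u \<squnion> d\<close> other than \<open>v\<close> satisfies \<open>a \<sqinter> d = c\<close> and \<open>a \<squnion> d = v\<close>,
  so that (D2) gives \<open>\<Delta>(a, v) = \<Delta>(c, d)\<close>. Hence a covering pair in the transposed interval either
  reaches its top, and has the same class as \<open>(c, d)\<close>, or its class is absorbed:
  \<open>\<Delta>(a, b) + \<Delta>(c, d) = \<Delta>(a, v) = \<Delta>(c, d)\<close>. The same holds for downward transposes. These equalities and
  absorptions are all that (D2) says about covering pairs, and they make \<open>Dim L\<close> a primitive
  monoid, one that embeds into a power of the extended natural numbers.

  The coordinates of this embedding are as follows. Fix a covering pair \<open>x\<close>, and weigh a covering
  pair \<open>y\<close> by \<open>\<infinity>\<close> if \<open>y\<close> absorbs \<open>x\<close>, by \<open>1\<close> if it has the same class as \<open>x\<close>, and by \<open>0\<close>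
  otherwise. Such a weight respects equality and absorption; a Jordan-Hoelder argument then shows
  that all maximal chains of an interval have the same total weight, and this total is a
  valuation \<open>f\<^sub>x\<close>, that is, a homomorphism from \<open>Dim L\<close> to the extended naturals
  (\<open>extends_to_valuation\<close>). The congruence of all pairs to which \<open>f\<^sub>x\<close> gives length zero is
  meet-irreducible: a strictly larger congruence collapses a covering pair of nonzero weight,
  hence also \<open>x\<close> (\<open>val_kernel_in_M_Con\<close>). Consequently \<open>f\<^sub>x\<close> is a valuation of one of the factors
  of \<open>Rect L\<close>, so it factors through \<open>Dim L \<rightarrow> Dim (Rect L)\<close> (\<open>separating_valuation\<close>).

  An inequality between two images in \<open>Dim (Rect L)\<close> therefore yields the inequality between all
  values of the \<open>f\<^sub>x\<close>. Conversely, these inequalities suffice in \<open>Dim L\<close>: summands of the smaller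
  side that the larger side absorbs can be discarded, and the others have finite multiplicities,
  which can be compared class by class (\<open>weight_sums_le_imp\<close>). Equality of all values gives
  equality in \<open>Dim L\<close>, because the difference is then absorbed by the smaller side.
\<close>


section \<open>Valuations with extended natural values\<close>

definition valuation :: "('a, 'b) gorder_scheme \<Rightarrow> ('a \<Rightarrow> 'a \<Rightarrow> enat) \<Rightarrow> bool" where
  "valuation L f \<longleftrightarrow>
     (\<forall>a\<in>carrier L. f a a = 0) \<and>
     (\<forall>a\<in>carrier L. \<forall>b\<in>carrier L. \<forall>c\<in>carrier L.
        a \<sqsubseteq>\<^bsub>L\<^esub> b \<longrightarrow> b \<sqsubseteq>\<^bsub>L\<^esub> c \<longrightarrow> f a c = f a b + f b c) \<and>
     (\<forall>a\<in>carrier L. \<forall>b\<in>carrier L. f a (a \<squnion>\<^bsub>L\<^esub> b) = f (a \<sqinter>\<^bsub>L\<^esub> b) b)"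

text \<open>
  The value at the class of \<open>M\<close> of the homomorphism from the dimension monoid that a valuation
  \<open>f\<close> induces.
\<close>

definition valuation_sum :: "('a \<Rightarrow> 'a \<Rightarrow> enat) \<Rightarrow> ('a \<times> 'a) multiset \<Rightarrow> enat" where
  "valuation_sum f M = (\<Sum>(a, b)\<in>#M. f a b)"

lemma valuation_sum_simps [simp]:
  "valuation_sum f {#} = 0"
  "valuation_sum f (add_mset (a, b) M) = f a b + valuation_sum f M"
  "valuation_sum f (M + N) = valuation_sum f M + valuation_sum f N"
  by (simp_all add: valuation_sum_def)

lemma valuation_sum_cong:
  "(\<And>a b. (a, b) \<in># M \<Longrightarrow> f a b = g a b) \<Longrightarrow> valuation_sum f M = valuation_sum g M"
  unfolding valuation_sum_def by (intro arg_cong[of _ _ sum_mset] image_mset_cong) auto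

lemma valuation_sum_infinity:
  "valuation_sum f M = \<infinity> \<Longrightarrow> \<exists>(a, b)\<in>#M. f a b = \<infinity>"
  by (induction M) (auto simp: plus_eq_infty_iff_enat)

lemma valuation_sum_nonzero:
  "valuation_sum f M \<noteq> 0 \<longleftrightarrow> (\<exists>(a, b)\<in>#M. f a b \<noteq> 0)"
  by (induction M) auto

lemma valuation_sum_dim_cong:
  assumes "valuation L f"
  shows "(M, N) \<in> dim_cong L \<Longrightarrow> valuation_sum f M = valuation_sum f N"
  by (induction rule: dim_cong.induct) (use assms in \<open>auto simp: valuation_def\<close>)

lemma valuation_comp_hom:
  assumes "lattice K" "lattice L" "h \<in> lattice_hom K L" "valuation L f"
  shows "valuation K (\<lambda>a b. f (h a) (h b))"
proof -
  have c: "h a \<in> carrier L" if "a \<in> carrier K" for a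
    using assms(3) that by (auto simp: lattice_hom_def)
  show ?thesis
    using assms(3,4) c lattice_hom_le[OF assms(1-3)] unfolding valuation_def lattice_hom_def
    by simp
qed

lemma valuation_sum_image:
  "valuation_sum f (image_mset (map_prod h h) M) = valuation_sum (\<lambda>a b. f (h a) (h b)) M"
  by (induction M) auto


section \<open>Covering pairs and maximal chains\<close>

definition covers :: "('a, 'b) gorder_scheme \<Rightarrow> 'a \<Rightarrow> 'a \<Rightarrow> bool" where
  "covers L c d \<longleftrightarrow> c \<in> carrier L \<and> d \<in> carrier L \<and> c \<sqsubseteq>\<^bsub>L\<^esub> d \<and> c \<noteq> d \<and>
     (\<forall>z\<in>carrier L. c \<sqsubseteq>\<^bsub>L\<^esub> z \<longrightarrow> z \<sqsubseteq>\<^bsub>L\<^esub> d \<longrightarrow> z = c \<or> z = d)"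

lemma covers_inv_gorder: "covers (inv_gorder L) d c \<longleftrightarrow> covers L c d"
  unfolding covers_def by auto

text \<open>
  The possible sums of \<open>w\<close> over the covering pairs of a maximal chain from \<open>a\<close> to \<open>b\<close>. This is a
  relation because different chains may have different sums when \<open>w\<close> is arbitrary.
\<close>

inductive chain_weight ::
  "('a, 'b) gorder_scheme \<Rightarrow> ('a \<Rightarrow> 'a \<Rightarrow> enat) \<Rightarrow> 'a \<Rightarrow> 'a \<Rightarrow> enat \<Rightarrow> bool"
  for L w where
  refl: "a \<in> carrier L \<Longrightarrow> chain_weight L w a a 0"
| step: "\<lbrakk>covers L a b; chain_weight L w b c n\<rbrakk> \<Longrightarrow> chain_weight L w a c (w a b + n)"

context lattice begin

lemma join_le_iff [simp]:
  "\<lbrakk>x \<in> carrier L; y \<in> carrier L; z \<in> carrier L\<rbrakk> \<Longrightarrow> x \<squnion> y \<sqsubseteq> z \<longleftrightarrow> x \<sqsubseteq> z \<and> y \<sqsubseteq> z"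
  by (meson join_closed join_le join_left join_right le_trans)

lemma le_meet_iff [simp]:
  "\<lbrakk>x \<in> carrier L; y \<in> carrier L; z \<in> carrier L\<rbrakk> \<Longrightarrow> z \<sqsubseteq> x \<sqinter> y \<longleftrightarrow> z \<sqsubseteq> x \<and> z \<sqsubseteq> y"
  by (meson meet_closed meet_le meet_left meet_right le_trans)

lemma absorption:
  assumes "a \<in> carrier L" "b \<in> carrier L"
  shows "(a \<squnion> b) \<sqinter> b = b" "(a \<sqinter> b) \<squnion> a = a"
  using assms meet_right[of "a \<squnion> b" b] join_right[of a b] join_right[of "a \<sqinter> b" a] meet_left[of a b]
  by (simp_all add: le_antisym)

lemma join_absorb: "\<lbrakk>a \<in> carrier L; b \<in> carrier L; a \<sqsubseteq> b\<rbrakk> \<Longrightarrow> a \<squnion> b = b"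
  using le_iff_meet by blast

lemma meet_absorb: "\<lbrakk>a \<in> carrier L; b \<in> carrier L; a \<sqsubseteq> b\<rbrakk> \<Longrightarrow> a \<sqinter> b = a"
  using le_iff_join by metis

lemma coversD:
  assumes "covers L c d"
  shows "c \<in> carrier L" "d \<in> carrier L" "c \<sqsubseteq> d" "c \<noteq> d" "\<not> d \<sqsubseteq> c"
    "\<And>z. \<lbrakk>z \<in> carrier L; c \<sqsubseteq> z; z \<sqsubseteq> d\<rbrakk> \<Longrightarrow> z = c \<or> z = d"
  using assms le_antisym by (auto simp: covers_def)

lemma chain_weight_le: "chain_weight L w a b n \<Longrightarrow> a \<in> carrier L \<and> b \<in> carrier L \<and> a \<sqsubseteq> b"
  by (induction rule: chain_weight.induct) (auto dest: coversD intro: le_trans)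

lemma chain_weight_self:
  assumes "chain_weight L w a a n"
  shows "n = 0"
  using assms
proof cases
  case (step b m)
  then show ?thesis using coversD(5)[OF step(2)] chain_weight_le[OF step(3)] by simp
qed

lemma chain_weight_trans:
  "chain_weight L w a b n \<Longrightarrow> chain_weight L w b c m \<Longrightarrow> chain_weight L w a c (n + m)"
  by (induction rule: chain_weight.induct) (auto simp: add.assoc intro: chain_weight.step)

lemma chain_weight_cover: "covers L a b \<Longrightarrow> chain_weight L w a b (w a b)"
  using chain_weight.step[OF _ chain_weight.refl, of L a b w] by (auto dest: coversD)

lemma meet_cover:
  assumes cd: "covers L c d" and u: "u \<in> carrier L" "c \<sqsubseteq> u" "\<not> d \<sqsubseteq> u"
  shows "u \<sqinter> d = c"
proof -
  note d = coversD[OF cd]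
  have "u \<sqinter> d = c \<or> u \<sqinter> d = d"
    using d u by (intro d(6)) (auto intro: meet_right)
  then show ?thesis using meet_left[OF u(1) d(2)] u(3) by auto
qed

lemma join_mono:
  "\<lbrakk>x \<in> carrier L; x' \<in> carrier L; y \<in> carrier L; y' \<in> carrier L; x \<sqsubseteq> x'; y \<sqsubseteq> y'\<rbrakk>
    \<Longrightarrow> x \<squnion> y \<sqsubseteq> x' \<squnion> y'"
  by simp (meson join_closed join_left join_right le_trans)

lemma exists_cover:
  assumes fin: "finite (carrier L)" and ab: "a \<in> carrier L" "b \<in> carrier L" "a \<sqsubseteq> b" "a \<noteq> b"
  obtains c where "covers L a c" "c \<sqsubseteq> b"
proof -
  define S where "S = {z \<in> carrier L. a \<sqsubseteq> z \<and> a \<noteq> z \<and> z \<sqsubseteq> b}"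
  define m where "m z = card {y \<in> carrier L. y \<sqsubseteq> z}" for z
  have "b \<in> S" using ab by (simp add: S_def)
  then obtain c where c: "c \<in> S" and min: "\<And>z. z \<in> S \<Longrightarrow> m c \<le> m z"
    using ex_has_least_nat[of "\<lambda>z. z \<in> S" b m] by blast
  have c': "c \<in> carrier L" "a \<sqsubseteq> c" "a \<noteq> c" "c \<sqsubseteq> b" using c by (auto simp: S_def)
  have "z = c" if z: "z \<in> carrier L" "a \<sqsubseteq> z" "z \<sqsubseteq> c" "z \<noteq> a" for z
  proof (rule ccontr)
    assume "z \<noteq> c"
    have "z \<in> S" using z c' ab le_trans[of z c b] by (auto simp: S_def)
    moreover have "{y \<in> carrier L. y \<sqsubseteq> z} \<subset> {y \<in> carrier L. y \<sqsubseteq> c}"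
      using z c' \<open>z \<noteq> c\<close> le_trans[of _ z c] le_antisym[of z c] by auto
    then have "m z < m c" unfolding m_def by (intro psubset_card_mono) (auto simp: fin)
    ultimately show False using min[of z] by simp
  qed
  then have "covers L a c" using c' ab by (auto simp: covers_def)
  then show thesis using c'(4) that by blast
qed

lemma card_above_less:
  assumes "finite (carrier L)" "covers L a b"
  shows "card {z \<in> carrier L. b \<sqsubseteq> z} < card {z \<in> carrier L. a \<sqsubseteq> z}"
  by (rule psubset_card_mono)
    (use assms coversD[OF assms(2)] le_trans[of a b] in auto)

lemma chain_weight_exists:
  assumes fin: "finite (carrier L)" and "a \<in> carrier L" "b \<in> carrier L" "a \<sqsubseteq> b"
  obtains n where "chain_weight L w a b n"
proof -
  have "\<exists>n. chain_weight L w a b n"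
    using assms(2-)
  proof (induction "card {z \<in> carrier L. a \<sqsubseteq> z}" arbitrary: a rule: less_induct)
    case less
    show ?case
    proof (cases "a = b")
      case True
      then show ?thesis using less.prems by (auto intro: chain_weight.refl)
    next
      case False
      then obtain c where "covers L a c" "c \<sqsubseteq> b"
        using exists_cover[OF fin] less.prems by metis
      then show ?thesis
        using less.hyps[OF card_above_less[OF fin]] less.prems coversD(2)
        by (meson chain_weight.step)
    qed
  qed
  then show thesis using that by blast
qed

end


section \<open>Valuations from weights of covering pairs\<close>

text \<open>
  Both conditions concern covering pairs inside an interval \<open>u, u \<squnion> d\<close> that transposes upwards
  from the covering pair \<open>(c, d)\<close>. They are the images under \<open>w\<close> of the relations that the
  dimension monoid forces between such pairs and \<open>(c, d)\<close>. The locale is one-sided, so that the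
  downward half is its instance for the dual order with the arguments of \<open>w\<close> exchanged.
\<close>

locale weighted_lattice = lattice L for L (structure) +
  fixes w :: "'a \<Rightarrow> 'a \<Rightarrow> enat"
  assumes fin: "finite (carrier L)"
    and weight_top: "\<lbrakk>covers L c d; u \<in> carrier L; c \<sqsubseteq> u; \<not> d \<sqsubseteq> u; u \<sqsubseteq> a; covers L a (u \<squnion> d)\<rbrakk>
      \<Longrightarrow> w a (u \<squnion> d) = w c d"
    and weight_absorb: "\<lbrakk>covers L c d; u \<in> carrier L; c \<sqsubseteq> u; \<not> d \<sqsubseteq> u; u \<sqsubseteq> a; covers L a b;
        b \<sqsubseteq> u \<squnion> d; b \<noteq> u \<squnion> d\<rbrakk> \<Longrightarrow> w a b + w c d = w c d"
begin

text \<open>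
  Every covering pair of the chain but the last is absorbed by \<open>w c d\<close>, and the last one has
  exactly this weight. So all maximal chains agree on intervals that transpose upwards from a
  covering pair, however long they are; this replaces semimodularity in the Jordan-Hoelder
  argument below.
\<close>

lemma transposed_chain_weight:
  assumes cd: "covers L c d"
  shows "\<lbrakk>chain_weight L w u v n; c \<sqsubseteq> u; \<not> d \<sqsubseteq> u; v = u \<squnion> d\<rbrakk> \<Longrightarrow> n = w c d"
proof (induction rule: chain_weight.induct)
  case (refl a)
  then show ?case using coversD[OF cd] join_right[of a d] by simp
next
  case (step a b v n)
  note d = coversD[OF cd] and ab = coversD[OF step.hyps(1)]
  have bv: "b \<sqsubseteq> v" "v \<in> carrier L" using chain_weight_le[OF step.hyps(2)] by auto
  show ?case
  proof (cases "b = v")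
    case True
    have "n = 0"
      using step.hyps(2) unfolding True by (rule chain_weight_self)
    then show ?thesis
      using weight_top[OF cd, of a a] step True ab by simp
  next
    case False
    have "\<not> d \<sqsubseteq> b"
    proof
      assume "d \<sqsubseteq> b"
      then have "v \<sqsubseteq> b" using step.prems ab d by simp
      then show False using bv False ab le_antisym by blast
    qed
    moreover have "v = b \<squnion> d"
    proof (rule le_antisym)
      show "v \<sqsubseteq> b \<squnion> d" using step.prems(3) ab d join_mono[of a b d d] by simp
      show "b \<squnion> d \<sqsubseteq> v" using step.prems(3) ab d bv join_right[of a d] by simp
    qed (use step.prems ab d in auto)
    moreover have "c \<sqsubseteq> b" using step.prems(1) ab d le_trans by blast
    ultimately have "n = w c d" by (intro step.IH)
    moreover have "w a b + w c d = w c d"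
      using weight_absorb[OF cd, of a a b] step ab bv False by simp
    ultimately show ?thesis by simp
  qed
qed

text \<open>
  The Jordan-Hoelder argument: two chains that start with different covers \<open>x\<close> and \<open>y\<close> of \<open>a\<close> are
  both compared with chains through \<open>x \<squnion> y\<close>. The intervals from \<open>x\<close> and from \<open>y\<close> to \<open>x \<squnion> y\<close>
  transpose upwards from \<open>(a, y)\<close> and \<open>(a, x)\<close>.
\<close>

lemma chain_weight_unique:
  "chain_weight L w a b n \<Longrightarrow> chain_weight L w a b m \<Longrightarrow> n = m"
proof (induction "card {z \<in> carrier L. a \<sqsubseteq> z}" arbitrary: a n m rule: less_induct)
  case less
  note IH = less.hyps[OF card_above_less[OF fin]]
  from less.prems(1) show ?case
  proof cases
    case refl
    then show ?thesis using less.prems(2) by (simp add: chain_weight_self)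
  next
    case (step x n')
    note x = step coversD[OF step(2)] chain_weight_le[OF step(3)]
    from less.prems(2) show ?thesis
    proof cases
      case refl
      then show ?thesis using less.prems(1) by (simp add: chain_weight_self)
    next
      case (step y m')
      note y = step coversD[OF step(2)] chain_weight_le[OF step(3)]
      show ?thesis
      proof (cases "x = y")
        case True
        then show ?thesis using IH[OF x(2), of n' m'] x y by simp
      next
        case False
        have ne: "\<not> x \<sqsubseteq> y" "\<not> y \<sqsubseteq> x"
          using x y False coversD(6)[OF x(2), of y] coversD(6)[OF y(2), of x] by metis+
        obtain k where k: "chain_weight L w (x \<squnion> y) b k"
          using chain_weight_exists[OF fin, of "x \<squnion> y" b w] x y by auto
        obtain k1 where k1: "chain_weight L w x (x \<squnion> y) k1"
          using chain_weight_exists[OF fin, of x "x \<squnion> y" w] x y join_left by auto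
        obtain k2 where k2: "chain_weight L w y (x \<squnion> y) k2"
          using chain_weight_exists[OF fin, of y "x \<squnion> y" w] x y join_right by auto
        \<comment> \<open>Both chains are replaced by chains through \<open>x \<squnion> y\<close> that share the part above it.\<close>
        have "n' = k1 + k" using IH[OF x(2) x(3) chain_weight_trans[OF k1 k]] .
        moreover have "m' = k2 + k" using IH[OF y(2) y(3) chain_weight_trans[OF k2 k]] .
        moreover have "k1 = w a y"
          using transposed_chain_weight[OF y(2) k1] x ne by simp
        moreover have "k2 = w a x"
          using transposed_chain_weight[OF x(2) k2] y ne join_comm[of L x y] by simp
        ultimately show ?thesis using x(1) y(1) by (simp add: ac_simps)
      qed
    qed
  qed
qed

definition chain_length :: "'a \<Rightarrow> 'a \<Rightarrow> enat" where
  "chain_length a b = (THE n. chain_weight L w a b n)"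

lemma chain_length_eq: "chain_weight L w a b n \<Longrightarrow> chain_length a b = n"
  unfolding chain_length_def using chain_weight_unique by blast

lemma chain_weight_chain_length:
  "\<lbrakk>a \<in> carrier L; b \<in> carrier L; a \<sqsubseteq> b\<rbrakk> \<Longrightarrow> chain_weight L w a b (chain_length a b)"
  by (metis chain_weight_exists[OF fin] chain_length_eq)

lemma chain_length_refl: "a \<in> carrier L \<Longrightarrow> chain_length a a = 0"
  by (intro chain_length_eq chain_weight.refl)

lemma chain_length_cover: "covers L a b \<Longrightarrow> chain_length a b = w a b"
  by (intro chain_length_eq chain_weight_cover)

lemma chain_length_add:
  "\<lbrakk>a \<in> carrier L; b \<in> carrier L; c \<in> carrier L; a \<sqsubseteq> b; b \<sqsubseteq> c\<rbrakk>
    \<Longrightarrow> chain_length a c = chain_length a b + chain_length b c"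
  using chain_weight_trans[OF chain_weight_chain_length chain_weight_chain_length]
  by (intro chain_length_eq) blast

text \<open>
  This identifies the chain length of the dual lattice with that of the lattice itself, although
  the two are built from opposite ends of the chains.
\<close>

lemma chain_length_unique:
  assumes refl: "\<And>a. a \<in> carrier L \<Longrightarrow> g a a = 0"
    and cover: "\<And>a b. covers L a b \<Longrightarrow> g a b = w a b"
    and add: "\<And>a b c. \<lbrakk>a \<in> carrier L; b \<in> carrier L; c \<in> carrier L; a \<sqsubseteq> b; b \<sqsubseteq> c\<rbrakk>
      \<Longrightarrow> g a c = g a b + g b c"
    and ab: "a \<in> carrier L" "b \<in> carrier L" "a \<sqsubseteq> b"
  shows "g a b = chain_length a b"
proof -
  have "g a b = n" if "chain_weight L w a b n" for n
    using that
  proof (induction rule: chain_weight.induct)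
    case (step a b c n)
    then show ?case
      using add[of a b c] cover[of a b] coversD[OF step.hyps(1)] chain_weight_le by metis
  qed (rule refl)
  then show ?thesis using chain_weight_chain_length[OF ab] by metis
qed

text \<open>
  Along a maximal chain from \<open>c\<close> to \<open>d\<close>, joining with \<open>e\<close> either collapses a covering pair or
  transposes it upwards, which preserves its weight.
\<close>

lemma chain_length_join_le:
  assumes "c \<in> carrier L" "d \<in> carrier L" "c \<sqsubseteq> d" and e: "e \<in> carrier L"
  shows "chain_length (c \<squnion> e) (d \<squnion> e) \<le> chain_length c d"
proof -
  have "chain_length (c \<squnion> e) (d \<squnion> e) \<le> n" if "chain_weight L w c d n" for n
    using that
  proof (induction rule: chain_weight.induct)
    case (refl a)
    then show ?case using e by (simp add: chain_length_refl)
  next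
    case (step a b d n)
    note ab = coversD[OF step.hyps(1)] and bd = chain_weight_le[OF step.hyps(2)]
    have "chain_length (a \<squnion> e) (b \<squnion> e) \<le> w a b"
    proof (cases "b \<sqsubseteq> a \<squnion> e")
      case True
      then have "b \<squnion> e = a \<squnion> e"
        using ab e join_right[of a e] join_mono[of a b e e] by (intro le_antisym) simp_all
      then show ?thesis using ab e by (simp add: chain_length_refl)
    next
      case False
      have eq: "b \<squnion> e = (a \<squnion> e) \<squnion> b"
      proof (rule le_antisym)
        show "b \<squnion> e \<sqsubseteq> (a \<squnion> e) \<squnion> b"
          using ab e join_right[of "a \<squnion> e" b] join_left[of "a \<squnion> e" b] by simp
        show "(a \<squnion> e) \<squnion> b \<sqsubseteq> b \<squnion> e"
          using ab e join_left[of b e] join_right[of b e] le_trans[of a b "b \<squnion> e"] by simp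
      qed (use ab e in auto)
      have "chain_weight L w (a \<squnion> e) (b \<squnion> e) (chain_length (a \<squnion> e) (b \<squnion> e))"
        using ab e by (intro chain_weight_chain_length join_mono) auto
      from transposed_chain_weight[OF step.hyps(1) this] show ?thesis
        using False eq ab e join_left by simp
    qed
    moreover have "chain_length (a \<squnion> e) (d \<squnion> e) =
      chain_length (a \<squnion> e) (b \<squnion> e) + chain_length (b \<squnion> e) (d \<squnion> e)"
      using ab bd e by (intro chain_length_add join_mono) auto
    ultimately show ?case using step.IH by (simp add: add_mono)
  qed
  then show ?thesis using chain_weight_chain_length assms by blast
qed

end

text \<open>
  Invariance under transposition consists of two inequalities: one is \<open>chain_length_join_le\<close> for
  the join with \<open>a\<close>, the other is its dual for the meet with \<open>b\<close>.
\<close>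

lemma (in weighted_lattice) extends_to_valuation:
  assumes "weighted_lattice (inv_gorder L) (\<lambda>a b. w b a)"
  obtains f where "valuation L f" "\<And>a b. covers L a b \<Longrightarrow> f a b = w a b"
proof -
  interpret dual: weighted_lattice "inv_gorder L" "\<lambda>a b. w b a" by fact
  have eq: "dual.chain_length b a = chain_length a b"
    if "a \<in> carrier L" "b \<in> carrier L" "a \<sqsubseteq> b" for a b
  proof (rule chain_length_unique[OF _ _ _ that])
    show "dual.chain_length c a = dual.chain_length b a + dual.chain_length c b"
      if "a \<in> carrier L" "b \<in> carrier L" "c \<in> carrier L" "a \<sqsubseteq> b" "b \<sqsubseteq> c" for a b c
      using dual.chain_length_add[of c b a] that by (simp add: add.commute)
    show "dual.chain_length b a = w a b" if "covers L a b" for a b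
      using that by (intro dual.chain_length_cover) (simp add: covers_inv_gorder)
  qed (simp add: dual.chain_length_refl)
  have "chain_length a (a \<squnion> b) = chain_length (a \<sqinter> b) b"
    if ab: "a \<in> carrier L" "b \<in> carrier L" for a b
  proof (rule antisym)
    have "chain_length (a \<sqinter> b \<squnion> a) (b \<squnion> a) \<le> chain_length (a \<sqinter> b) b"
      using ab by (intro chain_length_join_le meet_right) auto
    then show "chain_length a (a \<squnion> b) \<le> chain_length (a \<sqinter> b) b"
      using ab by (simp add: absorption join_comm[of L b a])
    have "dual.chain_length ((a \<squnion> b) \<sqinter> b) (a \<sqinter> b) \<le> dual.chain_length (a \<squnion> b) a"
      using ab dual.chain_length_join_le[of "a \<squnion> b" a b] join_left[of a b] by simp
    then show "chain_length (a \<sqinter> b) b \<le> chain_length a (a \<squnion> b)"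
      using ab eq[of "a \<sqinter> b" b] eq[of a "a \<squnion> b"] meet_right[of a b] join_left[of a b]
      by (simp add: absorption)
  qed
  then have "valuation L chain_length"
    using chain_length_refl chain_length_add unfolding valuation_def by blast
  then show thesis using chain_length_cover that by blast
qed


section \<open>Congruences and quotients from valuations\<close>

text \<open>
  For a valuation this is the congruence of all \<open>(a, b)\<close> with \<open>f (a \<sqinter> b) (a \<squnion> b) = 0\<close>. Arbitrary
  bounds \<open>l\<close> and \<open>u\<close> make its closure properties a matter of joining or meeting the bounds.
\<close>

definition val_kernel :: "('a, 'b) gorder_scheme \<Rightarrow> ('a \<Rightarrow> 'a \<Rightarrow> enat) \<Rightarrow> ('a \<times> 'a) set" where
  "val_kernel L f = {(a, b). a \<in> carrier L \<and> b \<in> carrier L \<and>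
     (\<exists>l\<in>carrier L. \<exists>u\<in>carrier L. l \<sqsubseteq>\<^bsub>L\<^esub> a \<and> l \<sqsubseteq>\<^bsub>L\<^esub> b \<and> a \<sqsubseteq>\<^bsub>L\<^esub> u \<and> b \<sqsubseteq>\<^bsub>L\<^esub> u \<and> f l u = 0)}"

lemma val_kernelI:
  assumes "a \<in> carrier L" "b \<in> carrier L" "l \<in> carrier L" "u \<in> carrier L"
    "l \<sqsubseteq>\<^bsub>L\<^esub> a" "l \<sqsubseteq>\<^bsub>L\<^esub> b" "a \<sqsubseteq>\<^bsub>L\<^esub> u" "b \<sqsubseteq>\<^bsub>L\<^esub> u" "f l u = 0"
  shows "(a, b) \<in> val_kernel L f"
  using assms unfolding val_kernel_def by blast

context lattice begin

context
  fixes f assumes val: "valuation L f"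
begin

lemma valuation_refl: "a \<in> carrier L \<Longrightarrow> f a a = 0"
  using val by (simp add: valuation_def)

lemma valuation_add:
  "\<lbrakk>a \<in> carrier L; b \<in> carrier L; c \<in> carrier L; a \<sqsubseteq> b; b \<sqsubseteq> c\<rbrakk> \<Longrightarrow> f a c = f a b + f b c"
  using val unfolding valuation_def by blast

lemma valuation_transpose:
  "\<lbrakk>a \<in> carrier L; b \<in> carrier L\<rbrakk> \<Longrightarrow> f a (a \<squnion> b) = f (a \<sqinter> b) b"
  using val by (simp add: valuation_def)

lemma valuation_mono:
  assumes "l \<in> carrier L" "a \<in> carrier L" "b \<in> carrier L" "u \<in> carrier L"
    and "l \<sqsubseteq> a" "a \<sqsubseteq> b" "b \<sqsubseteq> u"
  shows "f a b \<le> f l u"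
proof -
  have "f l u = f l a + f a u" "f a u = f a b + f b u"
    using assms le_trans[of a b u] by (auto intro!: valuation_add)
  then have "f l u = f a b + (f l a + f b u)" by (simp add: ac_simps)
  then show ?thesis by (metis le_iff_add)
qed

lemma valuation_join_le:
  assumes "c \<in> carrier L" "d \<in> carrier L" "c \<sqsubseteq> d" "e \<in> carrier L"
  shows "f (c \<squnion> e) (d \<squnion> e) \<le> f c d"
proof -
  have "d \<squnion> e = (c \<squnion> e) \<squnion> d"
    using assms join_left[of d e] join_right[of d e] join_left[of "c \<squnion> e" d] join_right[of "c \<squnion> e" d]
      le_trans[of c d "d \<squnion> e"]
    by (intro le_antisym) simp_all
  then have "f (c \<squnion> e) (d \<squnion> e) = f ((c \<squnion> e) \<sqinter> d) d"
    using assms valuation_transpose[of "c \<squnion> e" d] by simp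
  also have "\<dots> \<le> f c d"
    using assms join_left[of c e] meet_right[of "c \<squnion> e" d] by (intro valuation_mono) simp_all
  finally show ?thesis .
qed

lemma valuation_meet_le:
  assumes "c \<in> carrier L" "d \<in> carrier L" "c \<sqsubseteq> d" "e \<in> carrier L"
  shows "f (c \<sqinter> e) (d \<sqinter> e) \<le> f c d"
proof -
  have "c \<sqinter> e = c \<sqinter> (d \<sqinter> e)"
  proof (rule le_antisym)
    have "c \<sqinter> e \<sqsubseteq> d" using assms meet_left[of c e] by (intro le_trans[of "c \<sqinter> e" c d]) simp_all
    then show "c \<sqinter> e \<sqsubseteq> c \<sqinter> (d \<sqinter> e)"
      using assms by (intro meet_le meet_left meet_right) simp_all
    have "c \<sqinter> (d \<sqinter> e) \<sqsubseteq> e"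
      using assms meet_right[of c "d \<sqinter> e"] by simp
    then show "c \<sqinter> (d \<sqinter> e) \<sqsubseteq> c \<sqinter> e"
      using assms by (intro meet_le meet_left) simp_all
  qed (use assms in simp_all)
  then have "f (c \<sqinter> e) (d \<sqinter> e) = f c (c \<squnion> (d \<sqinter> e))"
    using assms valuation_transpose[of c "d \<sqinter> e"] by simp
  also have "\<dots> \<le> f c d"
    using assms meet_left[of d e] join_left[of c "d \<sqinter> e"] by (intro valuation_mono) simp_all
  finally show ?thesis .
qed

lemma val_kernel_eq_0:
  assumes "(a, b) \<in> val_kernel L f" "a \<sqsubseteq> b"
  shows "f a b = 0"
proof -
  obtain l u where lu: "l \<in> carrier L" "u \<in> carrier L" "l \<sqsubseteq> a" "b \<sqsubseteq> u" "f l u = 0"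
    and ab: "a \<in> carrier L" "b \<in> carrier L"
    using assms(1) by (auto simp: val_kernel_def)
  show ?thesis using valuation_mono[of l a b u] lu ab assms(2) by simp
qed

lemma val_kernel_congruence: "val_kernel L f \<in> congruences L"
proof -
  have "equiv (carrier L) (val_kernel L f)"
  proof (rule equivI)
    show "refl_on (carrier L) (val_kernel L f)"
      by (rule refl_onI) (auto simp: val_kernel_def intro!: valuation_refl)
    show "sym (val_kernel L f)" by (auto simp: val_kernel_def intro!: symI)
    show "trans (val_kernel L f)"
    proof (rule transI)
      fix a b c assume "(a, b) \<in> val_kernel L f" "(b, c) \<in> val_kernel L f"
      then obtain l u l' u' where
        c: "a \<in> carrier L" "b \<in> carrier L" "c \<in> carrier L"
          "l \<in> carrier L" "u \<in> carrier L" "l' \<in> carrier L" "u' \<in> carrier L" and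
        lu: "l \<sqsubseteq> a" "l \<sqsubseteq> b" "a \<sqsubseteq> u" "b \<sqsubseteq> u" "f l u = 0" and
        lu': "l' \<sqsubseteq> b" "l' \<sqsubseteq> c" "b \<sqsubseteq> u'" "c \<sqsubseteq> u'" "f l' u' = 0"
        by (auto simp: val_kernel_def)
      have "f (l \<sqinter> l') (u \<squnion> u') = f (l \<sqinter> l') l' + (f l' u' + f u' (u \<squnion> u'))"
        using c lu lu' meet_right[of l l'] join_right[of u u'] le_trans[of l' b u']
          le_trans[of l' u' "u \<squnion> u'"]
        by (simp add: valuation_add[of "l \<sqinter> l'" l' "u \<squnion> u'"] valuation_add[of l' u' "u \<squnion> u'"])
      also have "f (l \<sqinter> l') l' = f l (l \<squnion> l')" using c by (simp add: valuation_transpose)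
      also have "\<dots> = 0"
        using c lu lu' valuation_mono[of l l "l \<squnion> l'" u] join_left[of l l'] le_trans[of l b u]
          le_trans[of l' b u] by simp
      also have "f u' (u \<squnion> u') = f (u \<sqinter> u') u"
        using c valuation_transpose[of u' u] by (simp add: join_comm[of L u] meet_comm[of L u])
      also have "\<dots> = 0"
        using c lu lu' valuation_mono[of l "u \<sqinter> u'" u u] meet_left[of u u'] le_trans[of l b u']
          le_trans[of l b u] by simp
      finally have "f (l \<sqinter> l') (u \<squnion> u') = 0" using lu' by simp
      moreover have "l \<sqinter> l' \<sqsubseteq> a" "l \<sqinter> l' \<sqsubseteq> c" "a \<sqsubseteq> u \<squnion> u'" "c \<sqsubseteq> u \<squnion> u'"
        using c lu lu' by (meson meet_left meet_right join_left join_right le_trans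
            meet_closed join_closed)+
      ultimately show "(a, c) \<in> val_kernel L f"
        using c by (intro val_kernelI[of a L c "l \<sqinter> l'" "u \<squnion> u'"]) simp_all
    qed
  qed (auto simp: val_kernel_def)
  moreover have "(a \<squnion> b, a' \<squnion> b') \<in> val_kernel L f \<and> (a \<sqinter> b, a' \<sqinter> b') \<in> val_kernel L f"
    if ab: "(a, a') \<in> val_kernel L f" "(b, b') \<in> val_kernel L f" for a a' b b'
  proof -
    obtain l u l' u' where
      c: "a \<in> carrier L" "a' \<in> carrier L" "b \<in> carrier L" "b' \<in> carrier L"
        "l \<in> carrier L" "u \<in> carrier L" "l' \<in> carrier L" "u' \<in> carrier L" and
      lu: "l \<sqsubseteq> a" "l \<sqsubseteq> a'" "a \<sqsubseteq> u" "a' \<sqsubseteq> u" "f l u = 0" and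
      lu': "l' \<sqsubseteq> b" "l' \<sqsubseteq> b'" "b \<sqsubseteq> u'" "b' \<sqsubseteq> u'" "f l' u' = 0"
      using ab by (auto simp: val_kernel_def)
    have le: "l \<sqsubseteq> u" "l' \<sqsubseteq> u'" using c lu lu' le_trans by blast+
    have "f (l \<squnion> l') (u \<squnion> u') = f (l \<squnion> l') (u \<squnion> l') + f (u \<squnion> l') (u \<squnion> u')"
      using c le join_mono[of l u l' l'] join_mono[of u u l' u']
      by (intro valuation_add) simp_all
    then have j: "f (l \<squnion> l') (u \<squnion> u') = 0"
      using valuation_join_le[of l u l'] valuation_join_le[of l' u' u] c le lu lu'
      by (simp add: join_comm[of L u])
    have "f (l \<sqinter> l') (u \<sqinter> u') = f (l \<sqinter> l') (u \<sqinter> l') + f (u \<sqinter> l') (u \<sqinter> u')"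
      using c le meet_left[of l l'] meet_right[of l l'] meet_left[of u l'] meet_right[of u l']
        le_trans[of "l \<sqinter> l'" l u] le_trans[of "u \<sqinter> l'" l' u']
      by (intro valuation_add) simp_all
    then have m: "f (l \<sqinter> l') (u \<sqinter> u') = 0"
      using valuation_meet_le[of l u l'] valuation_meet_le[of l' u' u] c le lu lu'
      by (simp add: meet_comm[of L u])
    have "l \<squnion> l' \<sqsubseteq> a \<squnion> b" "l \<squnion> l' \<sqsubseteq> a' \<squnion> b'" "a \<squnion> b \<sqsubseteq> u \<squnion> u'" "a' \<squnion> b' \<sqsubseteq> u \<squnion> u'"
      using c lu lu' by (simp_all add: join_mono del: join_le_iff)
    moreover have "l \<sqinter> l' \<sqsubseteq> a \<sqinter> b" "l \<sqinter> l' \<sqsubseteq> a' \<sqinter> b'" "a \<sqinter> b \<sqsubseteq> u \<sqinter> u'" "a' \<sqinter> b' \<sqsubseteq> u \<sqinter> u'"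
      using c lu lu' by (meson meet_left meet_right le_trans meet_closed meet_le)+
    ultimately show ?thesis
      using c j m
      by (auto simp del: join_le_iff le_meet_iff
          intro: val_kernelI[of _ L _ "l \<squnion> l'" "u \<squnion> u'" f] val_kernelI[of _ L _ "l \<sqinter> l'" "u \<sqinter> u'" f])
  qed
  ultimately show ?thesis by (auto simp: congruences_def)
qed

text \<open>
  Both values equal the value at \<open>(a \<sqinter> a', b \<sqinter> b')\<close>, since the intervals from \<open>a \<sqinter> a'\<close> to \<open>a\<close> and
  from \<open>b \<sqinter> b'\<close> to \<open>b\<close> have value zero.
\<close>

lemma val_kernel_invariant:
  assumes "(a, a') \<in> val_kernel L f" "(b, b') \<in> val_kernel L f" "a \<sqsubseteq> b" "a' \<sqsubseteq> b'"
  shows "f a b = f a' b'"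
proof -
  note E = congruence_equiv[OF val_kernel_congruence]
  have *: "f a b = f (a \<sqinter> a') (b \<sqinter> b')"
    if "(a, a') \<in> val_kernel L f" "(b, b') \<in> val_kernel L f" "a \<sqsubseteq> b" "a' \<sqsubseteq> b'" for a a' b b'
  proof -
    have c: "a \<in> carrier L" "a' \<in> carrier L" "b \<in> carrier L" "b' \<in> carrier L"
      using that by (auto simp: val_kernel_def)
    have z: "f (x \<sqinter> x') x = 0" if "(x, x') \<in> val_kernel L f" for x x'
    proof -
      have "x \<in> carrier L" "x' \<in> carrier L" using that by (auto simp: val_kernel_def)
      moreover have "x \<sqinter> x = x" using calculation by (simp add: meet_absorb)
      moreover have "(x', x) \<in> val_kernel L f" "(x, x) \<in> val_kernel L f"
        using that E calculation by (auto simp: equiv_def refl_on_def dest: symD)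
      ultimately have "(x \<sqinter> x', x) \<in> val_kernel L f"
        using congruence_meet[OF val_kernel_congruence, of x x x' x] by simp
      then show ?thesis
        using val_kernel_eq_0 meet_left \<open>x \<in> carrier L\<close> \<open>x' \<in> carrier L\<close> by blast
    qed
    have le: "a \<sqinter> a' \<sqsubseteq> a" "a \<sqinter> a' \<sqsubseteq> b \<sqinter> b'" "b \<sqinter> b' \<sqsubseteq> b"
      using c that meet_left[of a a'] meet_right[of a a'] meet_left[of b b']
        le_trans[of "a \<sqinter> a'" a b] le_trans[of "a \<sqinter> a'" a' b'] by simp_all
    have "f (a \<sqinter> a') b = f (a \<sqinter> a') a + f a b"
      using c that le by (intro valuation_add) simp_all
    moreover have "f (a \<sqinter> a') b = f (a \<sqinter> a') (b \<sqinter> b') + f (b \<sqinter> b') b"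
      using c that le by (intro valuation_add) simp_all
    ultimately show ?thesis using z that by simp
  qed
  have "(a', a) \<in> val_kernel L f" "(b', b) \<in> val_kernel L f"
    using assms E by (auto simp: equiv_def dest: symD)
  then show ?thesis
    using *[OF assms] *[of a' a b' b] assms by (simp add: meet_comm)
qed

text \<open>
  The quotient valuation evaluates \<open>f\<close> at representatives. Those of the upper class are joined
  with those of the lower class, because representatives of comparable classes need not be
  comparable.
\<close>

lemma quotient_valuation:
  assumes p: "p \<in> congruences L" "p \<subseteq> val_kernel L f"
  obtains g where "valuation (quotient_lattice L p) g"
    and "\<And>a b. \<lbrakk>a \<in> carrier L; b \<in> carrier L; a \<sqsubseteq> b\<rbrakk> \<Longrightarrow> g (p `` {a}) (p `` {b}) = f a b"
proof
  define rep where "rep X = (SOME x. x \<in> X)" for X :: "'a set"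
  define g where "g X Y = f (rep X) (rep X \<squnion> rep Y)" for X Y
  note E = congruence_equiv[OF p(1)]
  let ?Q = "quotient_lattice L p"
  have rep: "(a, rep (p `` {a})) \<in> p" "rep (p `` {a}) \<in> carrier L" if "a \<in> carrier L" for a
  proof -
    have "a \<in> p `` {a}" using E that by (rule equiv_class_self)
    then have "rep (p `` {a}) \<in> p `` {a}" unfolding rep_def by (rule someI)
    then show "(a, rep (p `` {a})) \<in> p" by simp
    then show "rep (p `` {a}) \<in> carrier L" using E by (auto simp: equiv_def)
  qed
  show g: "g (p `` {a}) (p `` {b}) = f a b"
    if ab: "a \<in> carrier L" "b \<in> carrier L" "a \<sqsubseteq> b" for a b
  proof -
    have "(a \<squnion> b, rep (p `` {a}) \<squnion> rep (p `` {b})) \<in> p"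
      using congruence_join[OF p(1)] rep ab by blast
    then have "(b, rep (p `` {a}) \<squnion> rep (p `` {b})) \<in> p" using ab by (simp add: join_absorb)
    then have "f a b = g (p `` {a}) (p `` {b})"
      unfolding g_def using rep ab p join_left
      by (intro val_kernel_invariant) auto
    then show ?thesis by simp
  qed
  have cls: "p `` {a} = p `` {b}" if "(a, b) \<in> p" for a b
    using equiv_class_eq[OF E that] .
  show "valuation ?Q g"
    unfolding valuation_def
  proof (intro conjI ballI impI)
    fix X assume "X \<in> carrier ?Q"
    then obtain x where "x \<in> carrier L" "X = p `` {x}" using quotient_carrierE[OF p(1)] by metis
    then show "g X X = 0" using g[of x x] valuation_refl by simp
  next
    fix X Y Z assume XYZ: "X \<in> carrier ?Q" "Y \<in> carrier ?Q" "Z \<in> carrier ?Q"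
      "X \<sqsubseteq>\<^bsub>?Q\<^esub> Y" "Y \<sqsubseteq>\<^bsub>?Q\<^esub> Z"
    obtain x y z where c: "x \<in> carrier L" "y \<in> carrier L" "z \<in> carrier L"
      and eq: "X = p `` {x}" "Y = p `` {y}" "Z = p `` {z}"
      using XYZ quotient_carrierE[OF p(1)] by metis
    \<comment> \<open>Representatives of the three classes that form a chain.\<close>
    let ?y = "x \<squnion> y"
    let ?z = "?y \<squnion> z"
    have "(x \<squnion> y, y) \<in> p"
      using XYZ c by (simp add: eq quotient_le_iff[OF p(1)] quotient_le_join_iff[OF p(1)])
    then have y: "p `` {?y} = Y" using cls eq by simp
    then have "(?y \<squnion> z, z) \<in> p"
      using XYZ c by (simp add: y[symmetric] eq(3) quotient_le_iff[OF p(1)]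
          quotient_le_join_iff[OF p(1)])
    then have z: "p `` {?z} = Z" using cls eq by simp
    have "f x ?z = f x ?y + f ?y ?z" "x \<sqsubseteq> ?y" "?y \<sqsubseteq> ?z" "x \<sqsubseteq> ?z"
      using c join_left[of x y] join_left[of ?y z] le_trans[of x ?y ?z]
      by (auto intro!: valuation_add simp del: join_le_iff)
    then show "g X Z = g X Y + g Y Z"
      using g[of x ?z] g[of x ?y] g[of ?y ?z] c by (simp add: y z eq(1))
  next
    fix X Y assume XY: "X \<in> carrier ?Q" "Y \<in> carrier ?Q"
    then obtain x y where c: "x \<in> carrier L" "y \<in> carrier L" and eq: "X = p `` {x}" "Y = p `` {y}"
      using quotient_carrierE[OF p(1)] by metis
    then show "g X (X \<squnion>\<^bsub>?Q\<^esub> Y) = g (X \<sqinter>\<^bsub>?Q\<^esub> Y) Y"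
      using g[of x "x \<squnion> y"] g[of "x \<sqinter> y" y] valuation_transpose[of x y]
        join_left[of x y] meet_right[of x y]
      by (simp add: quotient_join[OF p(1)] quotient_meet[OF p(1)])
  qed
qed

text \<open>
  The valuation of \<open>L/p\<close> is pulled back along the projection of \<open>Rect L\<close> to the factor \<open>p\<close>.
\<close>

lemma Rect_valuation:
  assumes p: "p \<in> M_Con L" "p \<subseteq> val_kernel L f"
  obtains g where "valuation (Rect L) g"
    and "\<And>a b. \<lbrakk>a \<in> carrier L; b \<in> carrier L; a \<sqsubseteq> b\<rbrakk> \<Longrightarrow> g (rect_map L a) (rect_map L b) = f a b"
proof -
  note pc = M_Con_congruence[OF p(1)]
  let ?Q = "quotient_lattice L p"
  obtain g where g: "valuation ?Q g"
    "\<And>a b. \<lbrakk>a \<in> carrier L; b \<in> carrier L; a \<sqsubseteq> b\<rbrakk> \<Longrightarrow> g (p `` {a}) (p `` {b}) = f a b"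
    using quotient_valuation[OF pc p(2)] by blast
  have "(\<lambda>s. s p) \<in> lattice_hom (Rect L) ?Q"
    unfolding lattice_hom_def
    using product_join_meet[of "M_Con L" "quotient_lattice L", OF lattice_quotient[OF M_Con_congruence]] p(1)
    by (auto simp: Rect_def product_lattice_def[of "M_Con L"])
  then have "valuation (Rect L) (\<lambda>s t. g (s p) (t p))"
    using valuation_comp_hom[OF lattice_Rect lattice_quotient[OF pc] _ g(1)] by blast
  moreover have "g (rect_map L a p) (rect_map L b p) = f a b"
    if "a \<in> carrier L" "b \<in> carrier L" "a \<sqsubseteq> b" for a b
    using g(2)[OF that] p(1) by (simp add: rect_map_def)
  ultimately show thesis by (rule that)
qed

lemma exists_cover_nonzero:
  assumes fin: "finite (carrier L)" and ab: "a \<in> carrier L" "b \<in> carrier L" "a \<sqsubseteq> b" and "f a b \<noteq> 0"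
  obtains c d where "covers L c d" "a \<sqsubseteq> c" "d \<sqsubseteq> b" "f c d \<noteq> 0"
proof -
  obtain n where n: "chain_weight L f a b n" using chain_weight_exists[OF fin ab] .
  then have "f a b \<noteq> 0 \<Longrightarrow> \<exists>c d. covers L c d \<and> a \<sqsubseteq> c \<and> d \<sqsubseteq> b \<and> f c d \<noteq> 0"
  proof (induction rule: chain_weight.induct)
    case (refl a)
    then show ?case using valuation_refl by simp
  next
    case (step a b c n)
    note ab = coversD[OF step.hyps(1)] and bc = chain_weight_le[OF step.hyps(2)]
    have eq: "f a c = f a b + f b c" using ab bc by (intro valuation_add) auto
    show ?case
    proof (cases "f a b = 0")
      case True
      then obtain x y where "covers L x y" "b \<sqsubseteq> x" "y \<sqsubseteq> c" "f x y \<noteq> 0"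
        using step.IH step.prems eq by auto
      then show ?thesis using ab le_trans[of a b x] coversD(1) by blast
    next
      case False
      then show ?thesis using step.hyps(1) ab bc le_refl by blast
    qed
  qed
  then show thesis using assms that by blast
qed

end

lemma congruence_convex:
  assumes r: "r \<in> congruences L" and "(a, b) \<in> r" "c \<in> carrier L" "a \<sqsubseteq> c" "c \<sqsubseteq> b"
  shows "(a, c) \<in> r" "(c, b) \<in> r"
proof -
  have ab: "a \<in> carrier L" "b \<in> carrier L" "(c, c) \<in> r"
    using congruence_equiv[OF r] assms by (auto simp: equiv_def refl_on_def)
  have "a \<sqinter> c = a" "b \<sqinter> c = c" "a \<squnion> c = c" "b \<squnion> c = b"
    using ab assms meet_absorb[of c b] join_absorb[of c b]
    by (simp_all add: meet_absorb join_absorb meet_comm[of L b] join_comm[of L b])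
  then show "(a, c) \<in> r" "(c, b) \<in> r"
    using congruence_meet[OF r assms(2) ab(3)] congruence_join[OF r assms(2) ab(3)] by simp_all
qed

text \<open>
  This valuation shows that classes in the dimension monoid remember the generated congruences:
  if \<open>\<Delta>(a, b)\<close> is a summand of \<open>\<Delta>(c, d)\<close>, every congruence that contains \<open>(c, d)\<close> contains \<open>(a,
  b)\<close>.
\<close>

lemma congruence_valuation:
  assumes r: "r \<in> congruences L"
  shows "valuation L (\<lambda>a b. if (a, b) \<in> r then 0 else \<infinity>)"
proof -
  note E = congruence_equiv[OF r]
  have refl: "(a, a) \<in> r" if "a \<in> carrier L" for a
    using E that by (auto simp: equiv_def refl_on_def)
  have D1: "(a, c) \<in> r \<longleftrightarrow> (a, b) \<in> r \<and> (b, c) \<in> r"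
    if "a \<in> carrier L" "b \<in> carrier L" "c \<in> carrier L" "a \<sqsubseteq> b" "b \<sqsubseteq> c" for a b c
    using congruence_convex[OF r, of a c b] that E by (meson equiv_def transD)
  have D2: "(a, a \<squnion> b) \<in> r \<longleftrightarrow> (a \<sqinter> b, b) \<in> r"
    if ab: "a \<in> carrier L" "b \<in> carrier L" for a b
  proof
    assume "(a, a \<squnion> b) \<in> r"
    from congruence_meet[OF r this refl[OF ab(2)]] show "(a \<sqinter> b, b) \<in> r"
      using ab by (simp add: absorption)
  next
    assume "(a \<sqinter> b, b) \<in> r"
    from congruence_join[OF r this refl[OF ab(1)]] show "(a, a \<squnion> b) \<in> r"
      using ab by (simp add: absorption join_comm[of L b])
  qed
  show ?thesis
    unfolding valuation_def
  proof (intro conjI ballI impI)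
    fix a b c assume "a \<in> carrier L" "b \<in> carrier L" "c \<in> carrier L" "a \<sqsubseteq> b" "b \<sqsubseteq> c"
    from D1[OF this]
    show "(if (a, c) \<in> r then 0 else \<infinity>) =
      (if (a, b) \<in> r then 0 else \<infinity>) + (if (b, c) \<in> r then 0 else (\<infinity>::enat))"
      by simp
  qed (simp_all add: refl D2)
qed

text \<open>
  The hypothesis \<open>gen\<close> makes \<open>(x, y)\<close> belong to every congruence strictly above the kernel: such
  a congruence contains an interval of nonzero value and hence, by convexity, a covering pair of
  nonzero value. Two such congruences thus cannot intersect in the kernel, which omits \<open>(x, y)\<close>.
\<close>

lemma val_kernel_in_M_Con:
  assumes fin: "finite (carrier L)" and val: "valuation L f"
    and x: "x \<in> carrier L" "y \<in> carrier L" "x \<sqsubseteq> y" "f x y \<noteq> 0"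
    and gen: "\<And>r c d. \<lbrakk>r \<in> congruences L; covers L c d; f c d \<noteq> 0; (c, d) \<in> r\<rbrakk> \<Longrightarrow> (x, y) \<in> r"
  shows "val_kernel L f \<in> M_Con L"
proof -
  let ?p = "val_kernel L f"
  have xy: "(x, y) \<notin> ?p" using val_kernel_eq_0[OF val] x by blast
  have *: "(x, y) \<in> r" if r: "r \<in> congruences L" and sub: "?p \<subseteq> r" "?p \<noteq> r" for r
  proof -
    obtain a b where ab: "(a, b) \<in> r" "(a, b) \<notin> ?p" using sub by auto
    note E = congruence_equiv[OF r]
    have c: "a \<in> carrier L" "b \<in> carrier L" using ab E by (auto simp: equiv_def)
    have "(a \<sqinter> b, b \<sqinter> b) \<in> r" "(b \<squnion> b, a \<squnion> b) \<in> r"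
      using congruence_meet[OF r ab(1), of b b] congruence_join[OF r, of b a b b] E c ab(1)
      by (auto simp: equiv_def refl_on_def dest: symD)
    then have "(a \<sqinter> b, a \<squnion> b) \<in> r"
      using E c by (simp add: meet_absorb join_absorb) (meson equiv_def transD)
    moreover have "f (a \<sqinter> b) (a \<squnion> b) \<noteq> 0"
    proof
      assume "f (a \<sqinter> b) (a \<squnion> b) = 0"
      then have "(a, b) \<in> ?p"
        using c meet_left[of a b] meet_right[of a b] join_left[of a b] join_right[of a b]
        by (intro val_kernelI[of a L b "a \<sqinter> b" "a \<squnion> b"]) simp_all
      then show False using ab by simp
    qed
    moreover have "a \<sqinter> b \<sqsubseteq> a \<squnion> b"
      using c meet_left[of a b] join_left[of a b] le_trans by (meson join_closed meet_closed)
    ultimately obtain c' d where cd: "covers L c' d" "a \<sqinter> b \<sqsubseteq> c'" "d \<sqsubseteq> a \<squnion> b" "f c' d \<noteq> 0"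
      using exists_cover_nonzero[OF val fin, of "a \<sqinter> b" "a \<squnion> b"] c by auto
    have "(a \<sqinter> b, d) \<in> r"
      using congruence_convex(1)[OF r \<open>(a \<sqinter> b, a \<squnion> b) \<in> r\<close>, of d] cd coversD[OF cd(1)] c
        le_trans[of "a \<sqinter> b" c' d] by auto
    then have "(c', d) \<in> r"
      using congruence_convex(2)[OF r, of "a \<sqinter> b" d c'] cd coversD[OF cd(1)] by auto
    then show ?thesis using gen r cd by blast
  qed
  have "?p = q \<or> ?p = r" if "q \<in> congruences L" "r \<in> congruences L" "?p = q \<inter> r" for q r
    using *[of q] *[of r] that xy by blast
  then have "meet_irreducible (Con L) ?p"
    using val_kernel_congruence[OF val] by (auto simp: meet_irreducible_def Con_def Con_meet[unfolded Con_def])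
  moreover have "?p \<noteq> carrier L \<times> carrier L" using xy x by blast
  ultimately show ?thesis by (simp add: M_Con_def)
qed

end


section \<open>Absorption in the dimension monoid\<close>

declare dim_cong.trans [trans]

definition cover_multisets :: "('a, 'b) gorder_scheme \<Rightarrow> ('a \<times> 'a) multiset set" where
  "cover_multisets L = {M. \<forall>(c, d)\<in>#M. covers L c d}"

text \<open>
  For a covering pair \<open>x\<close> this is the supremum of all \<open>n\<close> with \<open>n \<Delta>(x) \<le> \<Delta>(c, d)\<close>. Absorption is
  tested first: if \<open>x\<close> absorbs itself, its own weight has to be infinite.
\<close>

definition absorption_weight ::
  "('a, 'b) gorder_scheme \<Rightarrow> 'a \<times> 'a \<Rightarrow> 'a \<Rightarrow> 'a \<Rightarrow> enat" where
  "absorption_weight L x c d =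
     (if ({#x, (c, d)#}, {#(c, d)#}) \<in> dim_cong L then \<infinity>
      else if ({#x#}, {#(c, d)#}) \<in> dim_cong L then 1 else 0)"

lemma cover_multisets_simps [simp]:
  "{#} \<in> cover_multisets L"
  "add_mset (c, d) M \<in> cover_multisets L \<longleftrightarrow> covers L c d \<and> M \<in> cover_multisets L"
  "M + N \<in> cover_multisets L \<longleftrightarrow> M \<in> cover_multisets L \<and> N \<in> cover_multisets L"
  by (auto simp: cover_multisets_def)

context lattice begin

lemma lattice_L: "lattice L" ..

lemmas dim_cong_free = dim_cong_subset[OF lattice_L]

lemma covers_free: "covers L c d \<Longrightarrow> {#(c, d)#} \<in> free_dim L"
  by (auto simp: free_dim_def intervals_def dest: coversD)

lemma cover_multisets_free: "M \<in> cover_multisets L \<Longrightarrow> M \<in> free_dim L"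
  by (auto simp: cover_multisets_def free_dim_def intervals_def dest: coversD)

lemma dim_cong_add_left: "\<lbrakk>(M, N) \<in> dim_cong L; P \<in> free_dim L\<rbrakk> \<Longrightarrow> (P + M, P + N) \<in> dim_cong L"
  by (intro dim_cong.add dim_cong.refl)

lemma dim_cong_add_right: "\<lbrakk>(M, N) \<in> dim_cong L; P \<in> free_dim L\<rbrakk> \<Longrightarrow> (M + P, N + P) \<in> dim_cong L"
  by (intro dim_cong.add dim_cong.refl)

text \<open>
  An element of the interval other than its top \<open>u \<squnion> d\<close> is not above \<open>d\<close>, so it meets \<open>d\<close> in \<open>c\<close>;
  then (D2) applies to it and \<open>d\<close>.
\<close>

lemma top_transpose:
  assumes cd: "covers L c d" and u: "u \<in> carrier L" "c \<sqsubseteq> u"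
    and a: "a \<in> carrier L" "u \<sqsubseteq> a" "a \<sqsubseteq> u \<squnion> d" "a \<noteq> u \<squnion> d"
  shows "({#(a, u \<squnion> d)#}, {#(c, d)#}) \<in> dim_cong L"
proof -
  note d = coversD[OF cd]
  have "\<not> d \<sqsubseteq> a" using a u d le_antisym[of a "u \<squnion> d"] by auto
  moreover have "c \<sqsubseteq> a" using le_trans[OF u(2) a(2)] d u a by simp
  ultimately have "a \<sqinter> d = c" using meet_cover[OF cd a(1)] by simp
  moreover have "a \<squnion> d = u \<squnion> d"
  proof (rule le_antisym)
    show "a \<squnion> d \<sqsubseteq> u \<squnion> d" using a u d join_right[of u d] by simp
    show "u \<squnion> d \<sqsubseteq> a \<squnion> d" by (rule join_mono) (use a u d in auto)
  qed (use a u d in auto)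
  ultimately show ?thesis using dim_cong.D2[OF a(1) d(2)] by simp
qed

lemma bottom_transpose:
  assumes cd: "covers L c d" and u: "u \<in> carrier L" "u \<sqsubseteq> d"
    and b: "b \<in> carrier L" "b \<sqsubseteq> u" "u \<sqinter> c \<sqsubseteq> b" "b \<noteq> u \<sqinter> c"
  shows "({#(u \<sqinter> c, b)#}, {#(c, d)#}) \<in> dim_cong L"
proof -
  note d = coversD[OF cd]
  have nb: "\<not> b \<sqsubseteq> c" using b u d le_antisym[of b "u \<sqinter> c"] by auto
  have bd: "b \<sqsubseteq> d" using le_trans[OF b(2) u(2)] d u b by simp
  have "c \<squnion> b = c \<or> c \<squnion> b = d"
    using d b bd join_left[of c b] by (intro d(6)) simp_all
  then have "c \<squnion> b = d" using nb join_right[OF d(1) b(1)] by auto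
  moreover have "c \<sqinter> b = u \<sqinter> c"
  proof (rule le_antisym)
    have "c \<sqinter> b \<sqsubseteq> u" by (rule le_trans[OF meet_right b(2)]) (use b d u in auto)
    then show "c \<sqinter> b \<sqsubseteq> u \<sqinter> c" using b d u meet_left[of c b] by simp
    show "u \<sqinter> c \<sqsubseteq> c \<sqinter> b" using b d u meet_right[of u c] by simp
  qed (use b d u in auto)
  ultimately show ?thesis using dim_cong.D2[OF d(1) b(1)] by (simp add: dim_cong.sym)
qed

text \<open>
  Splitting \<open>(a, u \<squnion> d)\<close> at \<open>b\<close> gives \<open>\<Delta>(c, d) = \<Delta>(a, u \<squnion> d) = \<Delta>(a, b) + \<Delta>(b, u \<squnion> d)\<close>, where the
  last summand is again \<open>\<Delta>(c, d)\<close>.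
\<close>

lemma upper_absorption:
  assumes cd: "covers L c d" and u: "u \<in> carrier L" "c \<sqsubseteq> u"
    and ab: "covers L a b" "u \<sqsubseteq> a" "b \<sqsubseteq> u \<squnion> d" "b \<noteq> u \<squnion> d"
  shows "({#(a, b), (c, d)#}, {#(c, d)#}) \<in> dim_cong L"
proof -
  note d = coversD[OF cd] and ab' = coversD[OF ab(1)]
  have le: "u \<sqsubseteq> b" "a \<sqsubseteq> u \<squnion> d"
    using le_trans[OF ab(2) ab'(3)] le_trans[OF ab'(3) ab(3)] u d ab' by simp_all
  have ne: "a \<noteq> u \<squnion> d" using ab ab' le_antisym by blast
  have "({#(b, u \<squnion> d)#}, {#(c, d)#}) \<in> dim_cong L"
    using cd u ab' le ab by (intro top_transpose)
  from dim_cong_add_left[OF dim_cong.sym[OF this] covers_free[OF ab(1)]]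
  have "({#(a, b), (c, d)#}, {#(a, b), (b, u \<squnion> d)#}) \<in> dim_cong L" by (simp add: add_mset_commute)
  also have "({#(a, b), (b, u \<squnion> d)#}, {#(a, u \<squnion> d)#}) \<in> dim_cong L"
    using u d ab ab' by (intro dim_cong.sym[OF dim_cong.D1]) simp_all
  also have "({#(a, u \<squnion> d)#}, {#(c, d)#}) \<in> dim_cong L"
    using cd u ab' ab(2) le ne by (intro top_transpose)
  finally show ?thesis .
qed

lemma lower_absorption:
  assumes cd: "covers L c d" and u: "u \<in> carrier L" "u \<sqsubseteq> d"
    and ab: "covers L a b" "b \<sqsubseteq> u" "u \<sqinter> c \<sqsubseteq> a" "a \<noteq> u \<sqinter> c"
  shows "({#(a, b), (c, d)#}, {#(c, d)#}) \<in> dim_cong L"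
proof -
  note d = coversD[OF cd] and ab' = coversD[OF ab(1)]
  have le: "a \<sqsubseteq> u" "u \<sqinter> c \<sqsubseteq> b"
    using le_trans[OF ab'(3) ab(2)] le_trans[OF ab(3) ab'(3)] u d ab' by simp_all
  have ne: "b \<noteq> u \<sqinter> c" using ab ab' le_antisym by blast
  have "({#(u \<sqinter> c, a)#}, {#(c, d)#}) \<in> dim_cong L"
    using cd u ab' le ab by (intro bottom_transpose)
  from dim_cong_add_left[OF dim_cong.sym[OF this] covers_free[OF ab(1)]]
  have "({#(a, b), (c, d)#}, {#(u \<sqinter> c, a), (a, b)#}) \<in> dim_cong L"
    by (simp add: add_mset_commute)
  also have "({#(u \<sqinter> c, a), (a, b)#}, {#(u \<sqinter> c, b)#}) \<in> dim_cong L"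
    using u d ab ab' by (intro dim_cong.sym[OF dim_cong.D1]) simp_all
  also have "({#(u \<sqinter> c, b)#}, {#(c, d)#}) \<in> dim_cong L"
    using cd u ab' ab(2) le ne by (intro bottom_transpose)
  finally show ?thesis .
qed

context
  fixes x assumes x: "{#x#} \<in> free_dim L"
begin

lemma absorption_weight_cong:
  assumes "({#(a, b)#}, {#(c, d)#}) \<in> dim_cong L"
  shows "absorption_weight L x a b = absorption_weight L x c d"
proof -
  have 1: "({#x, (c, d)#}, {#(c, d)#}) \<in> dim_cong L"
    if h: "({#(a, b)#}, {#(c, d)#}) \<in> dim_cong L" "({#x, (a, b)#}, {#(a, b)#}) \<in> dim_cong L"
    for a b c d
  proof -
    have "({#x, (c, d)#}, {#x, (a, b)#}) \<in> dim_cong L"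
      using dim_cong_add_left[OF dim_cong.sym[OF h(1)] x] by (simp add: add_mset_commute)
    also note h(2)
    also note h(1)
    finally show ?thesis .
  qed
  have 2: "({#x#}, {#(a, b)#}) \<in> dim_cong L \<longleftrightarrow> ({#x#}, {#(c, d)#}) \<in> dim_cong L"
    using assms dim_cong.sym dim_cong.trans by blast
  have "({#x, (a, b)#}, {#(a, b)#}) \<in> dim_cong L \<longleftrightarrow> ({#x, (c, d)#}, {#(c, d)#}) \<in> dim_cong L"
    using 1[OF assms] 1[OF dim_cong.sym[OF assms]] by blast
  with 2 show ?thesis by (simp add: absorption_weight_def)
qed

text \<open>
  Unless \<open>(c, d)\<close> absorbs \<open>x\<close>, the absorbed pair \<open>(a, b)\<close> has weight zero: if it absorbed \<open>x\<close> or
  had the class of \<open>x\<close>, then \<open>(c, d)\<close> would absorb \<open>x\<close> through it.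
\<close>

lemma absorption_weight_absorb:
  assumes "({#(a, b), (c, d)#}, {#(c, d)#}) \<in> dim_cong L"
  shows "absorption_weight L x a b + absorption_weight L x c d = absorption_weight L x c d"
proof (cases "({#x, (c, d)#}, {#(c, d)#}) \<in> dim_cong L")
  case True
  then show ?thesis by (simp add: absorption_weight_def)
next
  case False
  have y: "{#(c, d)#} \<in> free_dim L" using dim_cong_free[OF assms] by simp
  have "({#x, (a, b)#}, {#(a, b)#}) \<notin> dim_cong L"
  proof
    assume *: "({#x, (a, b)#}, {#(a, b)#}) \<in> dim_cong L"
    have "({#x, (c, d)#}, {#x, (a, b), (c, d)#}) \<in> dim_cong L"
      using dim_cong_add_left[OF dim_cong.sym[OF assms] x] by (simp add: add_mset_commute)
    also have "({#x, (a, b), (c, d)#}, {#(a, b), (c, d)#}) \<in> dim_cong L"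
      using dim_cong_add_right[OF * y] by (simp add: add_mset_commute)
    also note assms
    finally show False using False by simp
  qed
  moreover have "({#x#}, {#(a, b)#}) \<notin> dim_cong L"
  proof
    assume "({#x#}, {#(a, b)#}) \<in> dim_cong L"
    from dim_cong_add_right[OF this y]
    have "({#x, (c, d)#}, {#(a, b), (c, d)#}) \<in> dim_cong L" by (simp add: add_mset_commute)
    also note assms
    finally show False using False by simp
  qed
  ultimately show ?thesis by (simp add: absorption_weight_def)
qed

lemma absorption_weight_self: "absorption_weight L x (fst x) (snd x) \<noteq> 0"
  using x by (simp add: absorption_weight_def dim_cong.refl)

lemma absorption_weighted_lattice:
  assumes fin: "finite (carrier L)"
  shows "weighted_lattice L (absorption_weight L x)"
    and "weighted_lattice (inv_gorder L) (\<lambda>a b. absorption_weight L x b a)"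
proof -
  show "weighted_lattice L (absorption_weight L x)"
  proof (intro weighted_lattice.intro weighted_lattice_axioms.intro lattice_L fin)
    fix c d u a assume h: "covers L c d" "u \<in> carrier L" "c \<sqsubseteq> u" "\<not> d \<sqsubseteq> u" "u \<sqsubseteq> a"
      "covers L a (u \<squnion> d)"
    show "absorption_weight L x a (u \<squnion> d) = absorption_weight L x c d"
      using h coversD[OF h(6)] by (intro absorption_weight_cong top_transpose)
  next
    fix c d u a b assume h: "covers L c d" "u \<in> carrier L" "c \<sqsubseteq> u" "\<not> d \<sqsubseteq> u" "u \<sqsubseteq> a"
      "covers L a b" "b \<sqsubseteq> u \<squnion> d" "b \<noteq> u \<squnion> d"
    then show "absorption_weight L x a b + absorption_weight L x c d = absorption_weight L x c d"
      by (intro absorption_weight_absorb upper_absorption)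
  qed
  show "weighted_lattice (inv_gorder L) (\<lambda>a b. absorption_weight L x b a)"
  proof (intro weighted_lattice.intro weighted_lattice_axioms.intro dual_lattice;
      unfold covers_inv_gorder gorder.simps partial_object.simps eq_object.simps join_dual)
    show "finite (carrier L)" by (rule fin)
  next
    fix c d u a assume h: "covers L d c" "u \<in> carrier L" "u \<sqsubseteq> c" "\<not> u \<sqsubseteq> d" "a \<sqsubseteq> u"
      "covers L (u \<sqinter> d) a"
    show "absorption_weight L x (u \<sqinter> d) a = absorption_weight L x d c"
      using h coversD[OF h(6)] by (intro absorption_weight_cong bottom_transpose) auto
  next
    fix c d u a b assume h: "covers L d c" "u \<in> carrier L" "u \<sqsubseteq> c" "\<not> u \<sqsubseteq> d" "a \<sqsubseteq> u"
      "covers L b a" "u \<sqinter> d \<sqsubseteq> b" "b \<noteq> u \<sqinter> d"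
    then show "absorption_weight L x b a + absorption_weight L x d c = absorption_weight L x d c"
      by (intro absorption_weight_absorb lower_absorption)
  qed
qed

end

text \<open>
  The two nonzero cases of the weight are \<open>\<Delta>(x, y) + \<Delta>(c, d) = \<Delta>(c, d)\<close> and \<open>\<Delta>(x, y) = \<Delta>(c, d)\<close>.
  In both, a congruence that contains \<open>(c, d)\<close> contains \<open>(x, y)\<close>, as its valuation shows; so the
  kernel of \<open>f\<close> is meet-irreducible and \<open>f\<close> descends to a factor of \<open>Rect L\<close>.
\<close>

lemma separating_valuation:
  assumes fin: "finite (carrier L)" and xy: "covers L x y"
  obtains f g where "valuation L f" "\<And>c d. covers L c d \<Longrightarrow> f c d = absorption_weight L (x, y) c d"
    and "valuation (Rect L) g"
    and "\<And>a b. \<lbrakk>a \<in> carrier L; b \<in> carrier L; a \<sqsubseteq> b\<rbrakk> \<Longrightarrow> g (rect_map L a) (rect_map L b) = f a b"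
proof -
  note free = covers_free[OF xy] and w = absorption_weighted_lattice[OF covers_free[OF xy] fin]
  obtain f where f: "valuation L f"
    and cover: "\<And>c d. covers L c d \<Longrightarrow> f c d = absorption_weight L (x, y) c d"
    using weighted_lattice.extends_to_valuation[OF w] by blast
  have "(x, y) \<in> r"
    if r: "r \<in> congruences L" and cd: "covers L c d" "f c d \<noteq> 0" "(c, d) \<in> r" for r c d
  proof -
    let ?v = "\<lambda>a b. if (a, b) \<in> r then 0 else (\<infinity>::enat)"
    have "({#(x, y), (c, d)#}, {#(c, d)#}) \<in> dim_cong L \<or> ({#(x, y)#}, {#(c, d)#}) \<in> dim_cong L"
      using cd(2) unfolding cover[OF cd(1)] absorption_weight_def by (auto split: if_splits)
    then have "?v x y = 0"
      using valuation_sum_dim_cong[OF congruence_valuation[OF r], of "{#(x, y), (c, d)#}" "{#(c, d)#}"]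
        valuation_sum_dim_cong[OF congruence_valuation[OF r], of "{#(x, y)#}" "{#(c, d)#}"] cd(3)
      by (auto split: if_splits)
    then show ?thesis by (simp split: if_splits)
  qed
  moreover have "f x y \<noteq> 0" using absorption_weight_self[OF free] cover[OF xy] by simp
  ultimately have "val_kernel L f \<in> M_Con L"
    using coversD[OF xy] by (intro val_kernel_in_M_Con[OF fin f, of x y]) auto
  from Rect_valuation[OF f this subset_refl]
  obtain g where "valuation (Rect L) g"
    "\<And>a b. \<lbrakk>a \<in> carrier L; b \<in> carrier L; a \<sqsubseteq> b\<rbrakk> \<Longrightarrow> g (rect_map L a) (rect_map L b) = f a b"
    by blast
  then show thesis using f cover that by blast
qed


section \<open>Comparing elements of the dimension monoid\<close>

lemma cover_decomposition:
  assumes fin: "finite (carrier L)"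
  shows "M \<in> free_dim L \<Longrightarrow> \<exists>N\<in>cover_multisets L. (M, N) \<in> dim_cong L"
proof (induction M)
  case empty
  then show ?case by (auto intro: dim_cong.refl free_dim_empty bexI[of _ "{#}"])
next
  case (add i M)
  obtain a b where i: "i = (a, b)" by fastforce
  have ab: "a \<in> carrier L" "b \<in> carrier L" "a \<sqsubseteq> b" and M: "M \<in> free_dim L"
    using add.prems by (auto simp: i free_dim_def intervals_def)
  obtain N where N: "N \<in> cover_multisets L" "(M, N) \<in> dim_cong L" using add.IH[OF M] by blast
  \<comment> \<open>Only the chain matters here, so the weight is arbitrary.\<close>
  obtain n where "chain_weight L (\<lambda>_ _. 0) a b n" using chain_weight_exists[OF fin ab] .
  then have "\<exists>P\<in>cover_multisets L. ({#(a, b)#}, P) \<in> dim_cong L"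
  proof (induction rule: chain_weight.induct)
    case (refl a)
    then show ?case by (auto intro: dim_cong.D0 bexI[of _ "{#}"])
  next
    case (step a b c n)
    then obtain P where P: "P \<in> cover_multisets L" "({#(b, c)#}, P) \<in> dim_cong L" by blast
    have "({#(a, c)#}, {#(a, b)#} + {#(b, c)#}) \<in> dim_cong L"
      using dim_cong.D1[of a L b c] coversD[OF step.hyps(1)] chain_weight_le[OF step.hyps(2)]
      by (simp add: add_mset_commute)
    also have "({#(a, b)#} + {#(b, c)#}, {#(a, b)#} + P) \<in> dim_cong L"
      using P(2) covers_free[OF step.hyps(1)] by (rule dim_cong_add_left)
    finally show ?case using P(1) step.hyps(1) by (intro bexI[of _ "{#(a, b)#} + P"]) simp_all
  qed
  then obtain P where P: "P \<in> cover_multisets L" "({#(a, b)#}, P) \<in> dim_cong L" by blast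
  show ?case
    using dim_cong.add[OF P(2) N(2)] P(1) N(1) by (intro bexI[of _ "P + N"]) (auto simp: i)
qed

lemma absorbed_by_multiset:
  assumes "({#x, y#}, {#y#}) \<in> dim_cong L" "y \<in># N" "N \<in> free_dim L"
  shows "({#x#} + N, N) \<in> dim_cong L"
proof -
  obtain N' where N': "N = {#y#} + N'" using assms(2) by (metis mset_add add_mset_add_single add.commute)
  then have "N' \<in> free_dim L" using assms(3) by (simp add: free_dim_def)
  from dim_cong_add_right[OF assms(1) this] show ?thesis by (simp add: N' add_mset_commute)
qed

text \<open>
  By induction on the size of \<open>M\<close>. A summand \<open>x\<close> of \<open>M\<close> that \<open>N\<close> absorbs is dropped, because
  adding it to \<open>N\<close> changes nothing. If \<open>N\<close> absorbs no summand of \<open>M\<close>, then any summand \<open>x\<close> has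
  positive weight sum on \<open>N\<close>, which must come from some \<open>y\<close> in \<open>N\<close> with the class of \<open>x\<close>, and \<open>x\<close>
  and \<open>y\<close> are cancelled. The comparison is required only for \<open>z\<close> in \<open>M\<close>: for these the weight of
  \<open>y\<close> is finite in the second case, so that the inequality survives the cancellation.
\<close>

lemma weight_sums_le_imp:
  assumes "M \<in> cover_multisets L" "N \<in> cover_multisets L"
    and "\<And>z. z \<in># M \<Longrightarrow>
      valuation_sum (absorption_weight L z) M \<le> valuation_sum (absorption_weight L z) N"
  shows "\<exists>Z\<in>cover_multisets L. (M + Z, N) \<in> dim_cong L"
  using assms
proof (induction "size M" arbitrary: M N rule: less_induct)
  case less
  note M = less.prems(1) and N = less.prems(2) and le = less.prems(3)
  let ?s = "\<lambda>z. valuation_sum (absorption_weight L z)"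
  show ?case
  proof (cases "\<exists>x\<in>#M. \<exists>y\<in>#N. ({#x, y#}, {#y#}) \<in> dim_cong L")
    case True
    then obtain x y M' where x: "M = add_mset x M'" and y: "y \<in># N"
      and abs: "({#x, y#}, {#y#}) \<in> dim_cong L"
      by (metis mset_add)
    have M': "M' \<in> cover_multisets L" and xf: "{#x#} \<in> free_dim L"
      using M covers_free by (cases x; simp add: x)+
    have "?s z M' \<le> ?s z N" if "z \<in># M'" for z
    proof -
      have "?s z M' \<le> ?s z M" by (cases x) (simp add: x)
      then show ?thesis using le[of z] that by (simp add: x)
    qed
    then obtain Z where Z: "Z \<in> cover_multisets L" "(M' + Z, N) \<in> dim_cong L"
      using less.hyps[OF _ M' N] x by auto
    have "({#x#} + (M' + Z), {#x#} + N) \<in> dim_cong L" using Z(2) xf by (rule dim_cong_add_left)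
    also have "({#x#} + N, N) \<in> dim_cong L"
      using abs y cover_multisets_free[OF N] by (rule absorbed_by_multiset)
    finally show ?thesis using Z(1) by (auto simp: x)
  next
    case False
    show ?thesis
    proof (cases M)
      case empty
      then show ?thesis using N by (auto intro: dim_cong.refl cover_multisets_free)
    next
      case (add x M')
      obtain x1 x2 where x12: "x = (x1, x2)" by fastforce
      have M': "M' \<in> cover_multisets L" and x: "covers L x1 x2" using M by (simp_all add: add x12)
      have "?s x M \<noteq> 0"
        using absorption_weight_self[of x] covers_free[OF x] by (simp add: add x12)
      then have "?s x N \<noteq> 0" using le[of x] by (auto simp: add)
      then obtain y1 y2 where y: "(y1, y2) \<in># N" "absorption_weight L x y1 y2 \<noteq> 0"
        unfolding valuation_sum_nonzero by auto
      have xy: "({#x#}, {#(y1, y2)#}) \<in> dim_cong L"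
        using y False by (auto simp: absorption_weight_def add split: if_splits)
      obtain N' where N': "N = add_mset (y1, y2) N'" using y(1) by (metis mset_add)
      have "?s z M' \<le> ?s z N'" if z: "z \<in># M'" for z
      proof -
        have zf: "{#z#} \<in> free_dim L"
          using M' z covers_free by (cases z) (auto simp: cover_multisets_def)
        have "absorption_weight L z y1 y2 \<noteq> \<infinity>"
          using False z by (simp add: absorption_weight_def add N' del: not_infinity_eq)
        moreover have "absorption_weight L z x1 x2 = absorption_weight L z y1 y2"
          using xy x12 by (intro absorption_weight_cong zf) simp
        ultimately show ?thesis
          using le[of z] z by (auto simp: add N' x12 enat_add_left_cancel_le)
      qed
      then obtain Z where Z: "Z \<in> cover_multisets L" "(M' + Z, N') \<in> dim_cong L"
        using less.hyps[of M' N'] M' N by (auto simp: add N')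
      have "({#x#} + (M' + Z), {#(y1, y2)#} + N') \<in> dim_cong L"
        using xy Z(2) by (rule dim_cong.add)
      then show ?thesis using Z(1) by (auto simp: add N')
    qed
  qed
qed

lemma absorbed_multiset:
  assumes M: "M \<in> free_dim L"
  shows "(\<And>z. z \<in># Z \<Longrightarrow> ({#z#} + M, M) \<in> dim_cong L) \<Longrightarrow> (M + Z, M) \<in> dim_cong L"
proof (induction Z)
  case empty
  then show ?case using M by (simp add: dim_cong.refl)
next
  case (add z Z)
  have zM: "({#z#} + M, M) \<in> dim_cong L" using add.prems by simp
  then have "{#z#} \<in> free_dim L" using dim_cong_free[OF zM] by (simp add: free_dim_def)
  with add have "({#z#} + (M + Z), {#z#} + M) \<in> dim_cong L" by (intro dim_cong_add_left) auto
  also note zM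
  finally show ?case by simp
qed

end

text \<open>
  The second claim uses the multiset \<open>Z\<close> of the first. If both sides have the same weight sums,
  then for \<open>z\<close> in \<open>Z\<close> the nonzero weight sum of \<open>Z\<close> does not change that of \<open>M\<close>, which is
  therefore infinite; this means that \<open>M\<close> absorbs \<open>z\<close>. Hence \<open>M\<close> absorbs \<open>Z\<close> and equals \<open>N\<close> in
  the dimension monoid.
\<close>

lemma (in lattice) dim_cong_Rect_imp_le:
  assumes fin: "finite (carrier L)" and MN: "M \<in> free_dim L" "N \<in> free_dim L"
    and W: "(image_mset (map_prod (rect_map L) (rect_map L)) M + W,
      image_mset (map_prod (rect_map L) (rect_map L)) N) \<in> dim_cong (Rect L)"
  shows "\<exists>Z\<in>free_dim L. (M + Z, N) \<in> dim_cong L"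
    and "W = {#} \<Longrightarrow> (M, N) \<in> dim_cong L"
proof -
  let ?j = "image_mset (map_prod (rect_map L) (rect_map L))"
  let ?s = "\<lambda>z. valuation_sum (absorption_weight L z)"
  obtain M' N' where M': "M' \<in> cover_multisets L" "(M, M') \<in> dim_cong L"
    and N': "N' \<in> cover_multisets L" "(N, N') \<in> dim_cong L"
    using cover_decomposition[OF fin] MN by blast
  have sums: "?s (x, y) M' \<le> ?s (x, y) N' \<and> (W = {#} \<longrightarrow> ?s (x, y) M' = ?s (x, y) N')"
    if xy: "covers L x y" for x y
  proof -
    obtain f g where f: "valuation L f"
        "\<And>c d. covers L c d \<Longrightarrow> f c d = absorption_weight L (x, y) c d"
      and g: "valuation (Rect L) g"
        "\<And>a b. \<lbrakk>a \<in> carrier L; b \<in> carrier L; a \<sqsubseteq> b\<rbrakk> \<Longrightarrow> g (rect_map L a) (rect_map L b) = f a b"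
      using separating_valuation[OF fin xy] by blast
    have eq: "valuation_sum g (?j P) = ?s (x, y) P'"
      if "P \<in> free_dim L" "P' \<in> cover_multisets L" "(P, P') \<in> dim_cong L" for P P'
    proof -
      have "valuation_sum g (?j P) = valuation_sum f P"
        unfolding valuation_sum_image using that(1)
        by (intro valuation_sum_cong g(2)) (auto simp: free_dim_def intervals_def)
      also have "\<dots> = valuation_sum f P'" using f(1) that(3) by (rule valuation_sum_dim_cong)
      also have "\<dots> = ?s (x, y) P'"
        using that(2) by (intro valuation_sum_cong f(2)) (auto simp: cover_multisets_def)
      finally show ?thesis .
    qed
    have "valuation_sum g (?j M) + valuation_sum g W = valuation_sum g (?j N)"
      using valuation_sum_dim_cong[OF g(1) W] by simp
    then have "?s (x, y) N' = ?s (x, y) M' + valuation_sum g W" using eq MN M' N' by simp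
    then show ?thesis by (auto simp: le_iff_add)
  qed
  have "?s z M' \<le> ?s z N'" if "z \<in># M'" for z
    using sums that M'(1) by (cases z) (auto simp: cover_multisets_def)
  then obtain Z where Z: "Z \<in> cover_multisets L" "(M' + Z, N') \<in> dim_cong L"
    using weight_sums_le_imp[OF M'(1) N'(1)] by blast
  note Zf = cover_multisets_free[OF Z(1)] and M'f = cover_multisets_free[OF M'(1)]
  have "(M + Z, M' + Z) \<in> dim_cong L" using M'(2) Zf by (rule dim_cong_add_right)
  also note Z(2)
  also have "(N', N) \<in> dim_cong L" using N'(2) by (rule dim_cong.sym)
  finally show "\<exists>Z\<in>free_dim L. (M + Z, N) \<in> dim_cong L" using Zf by blast
  show "(M, N) \<in> dim_cong L" if "W = {#}"
  proof -
    have "({#z#} + M', M') \<in> dim_cong L" if z: "z \<in># Z" for z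
    proof -
      obtain x y where xy: "z = (x, y)" by fastforce
      have cov: "covers L x y" using z Z(1) by (auto simp: cover_multisets_def xy)
      obtain f where f: "valuation L f"
          "\<And>c d. covers L c d \<Longrightarrow> f c d = absorption_weight L z c d"
        using separating_valuation[OF fin cov] xy by metis
      have fs: "valuation_sum f P = ?s z P" if "P \<in> cover_multisets L" for P
        using that by (intro valuation_sum_cong f(2)) (auto simp: cover_multisets_def)
      have "?s z M' + ?s z Z = ?s z M'"
        using valuation_sum_dim_cong[OF f(1) Z(2)] fs M'(1) N'(1) Z(1) sums[OF cov] \<open>W = {#}\<close> xy
        by simp
      moreover have "?s z Z \<noteq> 0"
        using z absorption_weight_self[OF covers_free[OF cov]]
        by (auto simp: valuation_sum_nonzero xy)
      ultimately have "?s z M' = \<infinity>"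
        using enat_add_left_cancel[of "?s z M'" "?s z Z" 0] by simp
      then obtain c d where "(c, d) \<in># M'" "absorption_weight L z c d = \<infinity>"
        using valuation_sum_infinity by blast
      then show ?thesis
        using M'f by (intro absorbed_by_multiset) (auto simp: absorption_weight_def split: if_splits)
    qed
    then have "(M' + Z, M') \<in> dim_cong L" by (rule absorbed_multiset[OF M'f])
    note dim_cong.sym[OF this]
    also note Z(2)
    also have "(N', N) \<in> dim_cong L" using N'(2) by (rule dim_cong.sym)
    finally show ?thesis using M'(2) dim_cong.trans by blast
  qed
qed

theorem corollary7p16:
  fixes L :: "('a, 'b) gorder_scheme"
  assumes "lattice L" and "finite (carrier L)"
  shows "dimension_extension_property L (Rect L) (rect_map L)"
proof -
  interpret lattice L by fact
  note fin = assms(2) and L = assms(1) and R = lattice_Rect and j = rect_map_hom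
  let ?j = "image_mset (map_prod (rect_map L) (rect_map L))"
  let ?g = "Dim_map L (Rect L) (rect_map L)"
  have cls: "dim_cong K `` {M} = dim_cong K `` {N} \<longleftrightarrow> (M, N) \<in> dim_cong K"
    if "lattice K" "M \<in> free_dim K" "N \<in> free_dim K" for M N and K :: "('c, 'd) gorder_scheme"
    using eq_equiv_class_iff[OF equiv_dim_cong[OF that(1)] that(2,3)] .
  note jf = Dim_map_free[OF L R j] and jc = Dim_map_class[OF L R j]
  have "inj_on ?g (carrier (Dim L))"
  proof (rule inj_onI)
    fix X Y assume "X \<in> carrier (Dim L)" "Y \<in> carrier (Dim L)" and eq: "?g X = ?g Y"
    then obtain M N where M: "M \<in> free_dim L" "X = dim_cong L `` {M}"
      and N: "N \<in> free_dim L" "Y = dim_cong L `` {N}" by (metis carrier_DimE)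
    have "(?j M, ?j N) \<in> dim_cong (Rect L)" using eq M N jf by (simp add: jc cls[OF R])
    then have "(M, N) \<in> dim_cong L"
      using dim_cong_Rect_imp_le(2)[OF fin M(1) N(1), of "{#}"] by simp
    then show "X = Y" using M N by (simp add: cls[OF L])
  qed
  moreover have "alg_le (Dim L) X Y \<longleftrightarrow> alg_le (Dim (Rect L)) (?g X) (?g Y)"
    if XY: "X \<in> carrier (Dim L)" "Y \<in> carrier (Dim L)" for X Y
  proof
    assume "alg_le (Dim L) X Y"
    then obtain Z where "Z \<in> carrier (Dim L)" "X \<otimes>\<^bsub>Dim L\<^esub> Z = Y" by (auto simp: alg_le_def)
    then show "alg_le (Dim (Rect L)) (?g X) (?g Y)"
      using Dim_map_hom(1)[OF L R j] XY unfolding alg_le_def hom_def by blast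
  next
    assume "alg_le (Dim (Rect L)) (?g X) (?g Y)"
    then obtain Z' where Z': "Z' \<in> carrier (Dim (Rect L))" "?g X \<otimes>\<^bsub>Dim (Rect L)\<^esub> Z' = ?g Y"
      by (auto simp: alg_le_def)
    obtain M N where M: "M \<in> free_dim L" "X = dim_cong L `` {M}"
      and N: "N \<in> free_dim L" "Y = dim_cong L `` {N}" using XY by (metis carrier_DimE)
    obtain W where W: "W \<in> free_dim (Rect L)" "Z' = dim_cong (Rect L) `` {W}"
      using Z'(1) by (rule carrier_DimE)
    have "(?j M + W, ?j N) \<in> dim_cong (Rect L)"
      using Z'(2) M N W jf by (simp add: jc Dim_mult_class[OF R] cls[OF R] free_dim_add)
    then obtain Z where Z: "Z \<in> free_dim L" "(M + Z, N) \<in> dim_cong L"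
      using dim_cong_Rect_imp_le(1)[OF fin M(1) N(1)] by blast
    then have "X \<otimes>\<^bsub>Dim L\<^esub> dim_cong L `` {Z} = Y"
      using M N by (simp add: Dim_mult_class[OF L] cls[OF L] free_dim_add)
    then show "alg_le (Dim L) X Y" using class_in_Dim[OF Z(1)] unfolding alg_le_def by blast
  qed
  ultimately show ?thesis
    using Dim_map_hom[OF L R j]
    by (simp add: dimension_extension_property_def preordered_monoid_embedding_def)
qed

end
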